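(* Let $\mathbf{w}$ be an aperiodic infinite word over $\{0,1\}$. Then $\mathbf{w}$ belongs to $\mathcal{D}$ if and only if there exists an infinite word $\mathbf{u}$ over $\{0,1\}$ such that $100\mathbf{u}\preceq_{\mathrm{alt}}T^n\mathbf{w}\preceq_{\mathrm{alt}}011\mathbf{u}$ for all $n\ge0$. In this case, $\mathbf{u}=D\mathbf{c}_\theta$, where $\theta$ is the slope of $\mathbf{w}$, and $$100\mathbf{u}=\inf\nolimits^{\mathrm{alt}}_{n\ge0}T^n\mathbf{w},\qquad 011\mathbf{u}=\sup\nolimits^{\mathrm{alt}}_{n\ge0}T^n\mathbf{w},$$ where $\inf^{\mathrm{alt}}$ and $\sup^{\mathrm{alt}}$ denote the infimum and supremum, among infinite words over $\{0,1\}$, with respect to the order $\preceq_{\mathrm{alt}}$.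
   Context: Infinite words are sequences $\mathbf{w}=w_1w_2\dots$ indexed from $1$. An infinite word $w_1w_2\dots$ is aperiodic if there do not exist integers $k,N\ge1$ such that $w_n=w_{n+k}$ for all $n\ge N$. The slope of an infinite word $w_1w_2\dots$ over $\mathbb{Z}$ is $\lim_{n\to\infty}\frac1n\sum_{i=1}^nw_i$. An infinite word $s_1s_2\dots$ over $\{0,1\}$ is Sturmian if there exist an irrational $\theta\in(0,1)$ and $\rho\in\mathbb{R}$ such that either $s_n=\lfloor(n+1)\theta+\rho\rfloor-\lfloor n\theta+\rho\rfloor$ for all $n\ge1$, or $s_n=\lceil(n+1)\theta+\rho\rceil-\lceil n\theta+\rho\rceil$ for all $n\ge1$; it then has slope $\theta$. For irrational $\theta\in(0,1)$, the characteristic Sturmian word $\mathbf{c}_\theta=c_1c_2\dots$ is given by $c_n=\lfloor(n+1)\theta\rfloor-\lfloor n\theta\rfloor$, $n\ge1$. For $\mathbf{w}=w_1w_2\dots$, put $D\mathbf{w}=w_1w_1w_2w_2\dots$ and $T\mathbf{w}=w_2w_3\dots$. For a letter $a$, $a^l$ is the word $a\cdots a$ of length $l$. $\mathcal{D}$ is the set of infinite words over $\{0,1\}$ of the form $0^l(D\mathbf{s})$ or $1^l(D\mathbf{s})$, where $l\ge0$ and $\mathbf{s}$ is a Sturmian word. (Such a word has the same slope as $\mathbf{s}$.) $\preceq_{\mathrm{lex}}$ is the lexicographical order on infinite words over $\mathbb{Z}$. The alternate order: for infinite words $\mathbf{v},\mathbf{w}$ over $\mathbb{Z}$, $\mathbf{v}\preceq_{\mathrm{alt}}\mathbf{w}$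 means $N\mathbf{v}\preceq_{\mathrm{lex}}N\mathbf{w}$, where $N\mathbf{v}=(-v_1)v_2(-v_3)v_4\dots$. *)

theory Defs
  imports
    "HOL-Analysis.Analysis"
    "HOL-Library.Omega_Words_Fun"
    "HOL-Library.Fun_Lexorder"
begin

text \<open>
  An infinite word \<open>w\<^sub>1 w\<^sub>2 \<dots>\<close> is a function on the naturals whose value at \<open>n\<close> is the letter
  \<open>w\<^sub>n\<^sub>+\<^sub>1\<close>: positions start at 1 in the mathematics and at 0 here. The shift \<open>T\<^sup>n w\<close> is
  \<^term>\<open>suffix n w\<close>, and the concatenation of a finite and an infinite word is \<^term>\<open>v \<frown> w\<close>.
\<close>

definition binary_word :: "int word \<Rightarrow> bool" where
  "binary_word w \<longleftrightarrow> range w \<subseteq> {0, 1}"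

definition aperiodic :: "'a word \<Rightarrow> bool" where
  "aperiodic w \<longleftrightarrow> \<not> (\<exists>k N. k \<ge> 1 \<and> N \<ge> 1 \<and> (\<forall>n\<ge>N. w (n - 1) = w (n + k - 1)))"

definition has_slope :: "int word \<Rightarrow> real \<Rightarrow> bool" where
  "has_slope w \<theta> \<longleftrightarrow> (\<lambda>n. 1 / real n * (\<Sum>i=1..n. real_of_int (w (i - 1)))) \<longlonglongrightarrow> \<theta>"

definition sturmian :: "int word \<Rightarrow> bool" where
  "sturmian s \<longleftrightarrow> binary_word s \<and> (\<exists>\<theta> \<rho> :: real. \<theta> \<notin> \<rat> \<and> 0 < \<theta> \<and> \<theta> < 1 \<and>
     ((\<forall>n\<ge>1. s (n - 1) = \<lfloor>real (n + 1) * \<theta> + \<rho>\<rfloor> - \<lfloor>real n * \<theta> + \<rho>\<rfloor>) \<or>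
      (\<forall>n\<ge>1. s (n - 1) = \<lceil>real (n + 1) * \<theta> + \<rho>\<rceil> - \<lceil>real n * \<theta> + \<rho>\<rceil>)))"

text \<open>The value at \<open>k\<close> is \<open>c\<^sub>n\<close> with \<open>n = k + 1\<close>.\<close>

definition char_sturmian :: "real \<Rightarrow> int word" where
  "char_sturmian \<theta> = (\<lambda>k. \<lfloor>real (k + 2) * \<theta>\<rfloor> - \<lfloor>real (k + 1) * \<theta>\<rfloor>)"

text \<open>\<open>D w = w\<^sub>1 w\<^sub>1 w\<^sub>2 w\<^sub>2 \<dots>\<close>\<close>

definition double :: "'a word \<Rightarrow> 'a word" where
  "double w = (\<lambda>k. w (k div 2))"

definition doubled_sturmian :: "int word set" where
  "doubled_sturmian = {replicate l a \<frown> double s | l a s. a \<in> {0, 1} \<and> sturmian s}"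

definition lex_le :: "int word \<Rightarrow> int word \<Rightarrow> bool" where
  "lex_le v w \<longleftrightarrow> v = w \<or> less_fun v w"

text \<open>\<open>N v = (-v\<^sub>1) v\<^sub>2 (-v\<^sub>3) v\<^sub>4 \<dots>\<close>: the odd positions are the even arguments.\<close>

definition alt_neg :: "int word \<Rightarrow> int word" where
  "alt_neg v = (\<lambda>k. if even k then - v k else v k)"

definition alt_le :: "int word \<Rightarrow> int word \<Rightarrow> bool"  (infix \<open>\<preceq>\<^sub>a\<^sub>l\<^sub>t\<close> 50) where
  "v \<preceq>\<^sub>a\<^sub>l\<^sub>t w \<longleftrightarrow> lex_le (alt_neg v) (alt_neg w)"

text \<open>Infimum and supremum in the set of binary words, hence the quantification over binary bounds.\<close>

definition is_alt_inf :: "int word set \<Rightarrow> int word \<Rightarrow> bool" where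
  "is_alt_inf S x \<longleftrightarrow> binary_word x \<and> (\<forall>v\<in>S. x \<preceq>\<^sub>a\<^sub>l\<^sub>t v) \<and>
     (\<forall>y. binary_word y \<and> (\<forall>v\<in>S. y \<preceq>\<^sub>a\<^sub>l\<^sub>t v) \<longrightarrow> y \<preceq>\<^sub>a\<^sub>l\<^sub>t x)"

definition is_alt_sup :: "int word set \<Rightarrow> int word \<Rightarrow> bool" where
  "is_alt_sup S x \<longleftrightarrow> binary_word x \<and> (\<forall>v\<in>S. v \<preceq>\<^sub>a\<^sub>l\<^sub>t x) \<and>
     (\<forall>y. binary_word y \<and> (\<forall>v\<in>S. v \<preceq>\<^sub>a\<^sub>l\<^sub>t y) \<longrightarrow> x \<preceq>\<^sub>a\<^sub>l\<^sub>t y)"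

end

theory Submission
  imports Defs
begin

text \<open>
  Doubling reverses the order: \<open>v \<preceq>\<^sub>l\<^sub>e\<^sub>x w\<close> iff \<open>Dw \<preceq>\<^sub>a\<^sub>l\<^sub>t Dv\<close>, so that \<open>0c \<preceq>\<^sub>l\<^sub>e\<^sub>x T\<^sup>n s \<preceq>\<^sub>l\<^sub>e\<^sub>x 1c\<close> for a Sturmian
  word \<open>s\<close> becomes the pair of alternate bounds for \<open>Ds\<close> with \<open>u = Dc\<close>. These bounds are approached
  because multiples of \<open>\<theta>\<close> modulo 1 are dense: suffixes of \<open>s\<close> agree with \<open>10c\<close> and with \<open>01c\<close> on
  arbitrarily long prefixes. This gives the infimum and the supremum and makes \<open>u\<close> unique.

  Conversely, the alternate bounds exclude runs of odd length except for the first one, hence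
  \<open>w = a\<^sup>l (Ds)\<close>. Back in the lexicographic order they say that \<open>y \<preceq>\<^sub>l\<^sub>e\<^sub>x z\<close> whenever \<open>1y\<close> and \<open>0z\<close> are
  suffixes of \<open>s\<close>. Therefore \<open>s\<close> has no factors \<open>1p1\<close> and \<open>0p0\<close>, i.e. it is balanced, and an aperiodic
  balanced word is Sturmian.
\<close>

section \<open>The alternate order on words\<close>

lemma alt_neg_nth_eq_iff: "alt_neg v i = alt_neg w i \<longleftrightarrow> v i = w i"
  by (simp add: alt_neg_def)

lemma alt_neg_eq_iff: "alt_neg v = alt_neg w \<longleftrightarrow> v = w"
  by (simp add: fun_eq_iff alt_neg_nth_eq_iff)

lemma alt_le_iff:
  "v \<preceq>\<^sub>a\<^sub>l\<^sub>t w \<longleftrightarrow> v = w \<or> (\<exists>k. (\<forall>i<k. v i = w i) \<and> (if even k then w k < v k else v k < w k))"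
proof -
  have "alt_neg v k < alt_neg w k \<longleftrightarrow> (if even k then w k < v k else v k < w k)" for k
    by (simp add: alt_neg_def)
  then show ?thesis
    by (auto simp: alt_le_def lex_le_def less_fun_def alt_neg_eq_iff alt_neg_nth_eq_iff)
qed

lemma lex_le_iff: "lex_le v w \<longleftrightarrow> v = w \<or> (\<exists>k. (\<forall>i<k. v i = w i) \<and> v k < w k)"
  by (auto simp: lex_le_def less_fun_def)

lemma first_difference:
  assumes "v \<noteq> (w :: 'a word)"
  obtains k where "\<forall>i<k. v i = w i" and "v k \<noteq> w k"
proof -
  have "\<exists>k. v k \<noteq> w k"
    using assms by auto
  then show thesis
    using that[of "LEAST k. v k \<noteq> w k"] LeastI_ex[of "\<lambda>k. v k \<noteq> w k"] not_less_Least by blast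
qed

lemma lex_le_linear: "lex_le v w \<or> lex_le w v"
proof (cases "v = w")
  case False
  then obtain k where "\<forall>i<k. v i = w i" "v k \<noteq> w k"
    by (rule first_difference)
  then show ?thesis
    unfolding lex_le_iff by (metis linorder_neqE)
qed (simp add: lex_le_iff)

lemma lex_le_trans: "lex_le u v \<Longrightarrow> lex_le v w \<Longrightarrow> lex_le u w"
  by (auto simp: lex_le_def intro: less_fun_trans)

lemma lex_le_antisym: "lex_le v w \<Longrightarrow> lex_le w v \<Longrightarrow> v = w"
  by (auto simp: lex_le_def dest: less_fun_asym)

lemma alt_le_refl [simp]: "v \<preceq>\<^sub>a\<^sub>l\<^sub>t v"
  by (simp add: alt_le_iff)

lemma alt_le_linear: "v \<preceq>\<^sub>a\<^sub>l\<^sub>t w \<or> w \<preceq>\<^sub>a\<^sub>l\<^sub>t v"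
  by (simp add: alt_le_def lex_le_linear)

lemma alt_le_trans: "u \<preceq>\<^sub>a\<^sub>l\<^sub>t v \<Longrightarrow> v \<preceq>\<^sub>a\<^sub>l\<^sub>t w \<Longrightarrow> u \<preceq>\<^sub>a\<^sub>l\<^sub>t w"
  unfolding alt_le_def by (rule lex_le_trans)

lemma alt_le_antisym: "v \<preceq>\<^sub>a\<^sub>l\<^sub>t w \<Longrightarrow> w \<preceq>\<^sub>a\<^sub>l\<^sub>t v \<Longrightarrow> v = w"
  unfolding alt_le_def by (drule (1) lex_le_antisym) (simp add: alt_neg_eq_iff)

text \<open>Prepending a letter flips the parity of every later position, so the tails are compared
  in the opposite direction. Bounds with explicit prefixes such as \<open>[1, 0, 0]\<close> are
  evaluated by iterating this rule.\<close>

lemma alt_le_build: "a ## v \<preceq>\<^sub>a\<^sub>l\<^sub>t b ## w \<longleftrightarrow> b < a \<or> a = b \<and> w \<preceq>\<^sub>a\<^sub>l\<^sub>t v"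
proof
  assume "a ## v \<preceq>\<^sub>a\<^sub>l\<^sub>t b ## w"
  then consider "a ## v = b ## w" | k where "\<forall>i<k. (a ## v) i = (b ## w) i"
    "if even k then (b ## w) k < (a ## v) k else (a ## v) k < (b ## w) k"
    unfolding alt_le_iff by blast
  then show "b < a \<or> a = b \<and> w \<preceq>\<^sub>a\<^sub>l\<^sub>t v"
  proof cases
    case (2 k)
    show ?thesis
    proof (cases k)
      case (Suc j)
      have "v i = w i" if "i < j" for i
        using 2(1)[rule_format, of "Suc i"] that Suc by simp
      moreover have "a = b"
        using 2(1)[rule_format, of 0] Suc by simp
      ultimately show ?thesis
        using 2(2) Suc unfolding alt_le_iff by (intro disjI2 conjI exI[of _ j]) (auto split: if_splits)
    qed (use 2 in auto)
  qed simp
next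
  assume "b < a \<or> a = b \<and> w \<preceq>\<^sub>a\<^sub>l\<^sub>t v"
  then show "a ## v \<preceq>\<^sub>a\<^sub>l\<^sub>t b ## w"
  proof
    assume "b < a"
    then show ?thesis
      unfolding alt_le_iff by (intro disjI2 exI[of _ 0]) simp
  next
    assume *: "a = b \<and> w \<preceq>\<^sub>a\<^sub>l\<^sub>t v"
    then consider "v = w" | j where "\<forall>i<j. w i = v i" "if even j then v j < w j else w j < v j"
      by (auto simp only: alt_le_iff)
    then show ?thesis
    proof cases
      case (2 j)
      with * show ?thesis
        unfolding alt_le_iff by (intro disjI2 exI[of _ "Suc j"]) (auto simp: less_Suc_eq_0_disj)
    qed (use * in simp)
  qed
qed

lemma build_nth: "(a ## w) n = (if n = 0 then a else w (n - 1))"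
  by (cases n) simp_all

lemma suffix_unfold: "suffix n w = w n ## suffix (Suc n) w"
  using build_first[of "suffix n w"] by simp

section \<open>Doubled words\<close>

lemma double_build: "double (a ## v) = a ## a ## double v"
proof
  fix k
  show "double (a ## v) k = (a ## a ## double v) k"
  proof (cases k)
    case (Suc j)
    then show ?thesis by (cases j) (simp_all add: double_def)
  qed (simp add: double_def)
qed

text \<open>The first difference of two doubled words falls on an even index, \<open>2 * k\<close>,
  where the alternate order reverses the order of the letters.\<close>

lemma double_antimono: assumes "lex_le v w" shows "double w \<preceq>\<^sub>a\<^sub>l\<^sub>t double v"
proof -
  from assms consider "v = w" | k where "\<forall>i<k. v i = w i" "v k < w k"
    unfolding lex_le_iff by blast
  then show ?thesis
  proof cases
    case (2 k)
    then have "\<forall>i<2 * k. double w i = double v i"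
      by (auto simp: double_def)
    with 2 show ?thesis
      unfolding alt_le_iff by (intro disjI2 exI[of _ "2 * k"]) (simp add: double_def)
  qed simp
qed

lemma inj_double: "double v = double w \<longleftrightarrow> v = w"
proof
  assume "double v = double w"
  then have "double v (2 * k) = double w (2 * k)" for k by simp
  then show "v = w" by (auto simp: double_def)
qed simp

text \<open>The converse of \<open>double_antimono\<close> comes from linearity of the lexicographic
  order and injectivity of doubling.\<close>

lemma double_le_iff: "double w \<preceq>\<^sub>a\<^sub>l\<^sub>t double v \<longleftrightarrow> lex_le v w"
  by (metis alt_le_antisym double_antimono inj_double lex_le_linear)

lemma binary_word_iff: "binary_word w \<longleftrightarrow> (\<forall>n. w n = 0 \<or> w n = 1)"
  by (auto simp: binary_word_def)

text \<open>If \<open>y\<close> contains a 1, the words first differ where \<open>y\<close> has its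
  first 1, which the added letter delays. With its mirror image for 1, this carries bounds along
  runs of equal letters in \<open>alt_bounded_double_order\<close>.\<close>

lemma zero_build_lex_le: assumes "binary_word y" shows "lex_le (0 ## y) y"
proof (cases "\<exists>k. y k = 1")
  case True
  define k where "k = (LEAST k. y k = 1)"
  have "y k = 1" "\<And>i. i < k \<Longrightarrow> y i = 0"
    using True assms not_less_Least unfolding k_def binary_word_iff by (auto intro: LeastI)
  then show ?thesis
    unfolding lex_le_iff by (intro disjI2 exI[of _ k]) (auto simp: build_nth)
next
  case False
  then have "y = (\<lambda>_. 0)" using assms by (auto simp: binary_word_iff)
  then have "0 ## y = y" by (auto simp: build_nth fun_eq_iff)
  then show ?thesis by (simp add: lex_le_def)
qed

lemma one_build_lex_le: assumes "binary_word y" shows "lex_le y (1 ## y)"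
proof (cases "\<exists>k. y k = 0")
  case True
  define k where "k = (LEAST k. y k = 0)"
  have "y k = 0" "\<And>i. i < k \<Longrightarrow> y i = 1"
    using True assms not_less_Least unfolding k_def binary_word_iff by (auto intro: LeastI)
  then show ?thesis
    unfolding lex_le_iff by (intro disjI2 exI[of _ k]) (auto simp: build_nth)
next
  case False
  then have "y = (\<lambda>_. 1)" using assms by (auto simp: binary_word_iff)
  then have "1 ## y = y" by (auto simp: build_nth fun_eq_iff)
  then show ?thesis by (simp add: lex_le_def)
qed

section \<open>The alternate bounds and the exchange of 0 and 1\<close>

definition alt_bounded :: "int word \<Rightarrow> int word \<Rightarrow> bool" where
  "alt_bounded u w \<longleftrightarrow>
     (\<forall>n. [1, 0, 0] \<frown> u \<preceq>\<^sub>a\<^sub>l\<^sub>t suffix n w \<and> suffix n w \<preceq>\<^sub>a\<^sub>l\<^sub>t [0, 1, 1] \<frown> u)"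

text \<open>Words beginning with 1 precede those beginning with 0, so the first letter settles one
  of the two bounds and only the other one constrains the tail.\<close>

lemma alt_bounded_iff:
  assumes "binary_word w"
  shows "alt_bounded u w \<longleftrightarrow>
    (\<forall>n. (w n = 1 \<longrightarrow> suffix (Suc n) w \<preceq>\<^sub>a\<^sub>l\<^sub>t 0 ## 0 ## u) \<and>
         (w n = 0 \<longrightarrow> 1 ## 1 ## u \<preceq>\<^sub>a\<^sub>l\<^sub>t suffix (Suc n) w))"
proof -
  have *: "([1, 0, 0] \<frown> u \<preceq>\<^sub>a\<^sub>l\<^sub>t a ## v \<and> a ## v \<preceq>\<^sub>a\<^sub>l\<^sub>t [0, 1, 1] \<frown> u) \<longleftrightarrow>
      (a = 1 \<longrightarrow> v \<preceq>\<^sub>a\<^sub>l\<^sub>t 0 ## 0 ## u) \<and> (a = 0 \<longrightarrow> 1 ## 1 ## u \<preceq>\<^sub>a\<^sub>l\<^sub>t v)"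
    if "a = 0 \<or> a = 1" for a v
    using that by (auto simp: alt_le_build)
  show ?thesis
    using *[of "w n" "suffix (Suc n) w" for n] assms
    unfolding alt_bounded_def suffix_unfold[symmetric] binary_word_iff by blast
qed

definition compl_word :: "int word \<Rightarrow> int word" where
  "compl_word w = (\<lambda>n. 1 - w n)"

lemma compl_word_nth [simp]: "compl_word w n = 1 - w n"
  by (simp add: compl_word_def)

lemma compl_word_build: "compl_word (a ## w) = (1 - a) ## compl_word w"
  by (rule ext) (simp add: build_nth)

lemma suffix_compl_word: "suffix n (compl_word w) = compl_word (suffix n w)"
  by (rule ext) simp

lemma binary_word_compl: "binary_word (compl_word w) \<longleftrightarrow> binary_word w"
  by (auto simp: binary_word_iff)

lemma compl_word_alt_le: "compl_word v \<preceq>\<^sub>a\<^sub>l\<^sub>t compl_word w \<longleftrightarrow> w \<preceq>\<^sub>a\<^sub>l\<^sub>t v"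
proof -
  have "compl_word v = compl_word w \<longleftrightarrow> w = v"
    by (auto simp: fun_eq_iff)
  then show ?thesis
    unfolding alt_le_iff by (simp add: eq_commute)
qed

text \<open>Exchanging 0 and 1 reverses the alternate order and exchanges the roles of the two
  bounding words. Facts on runs of ones thereby yield facts on runs of zeros.\<close>

lemma alt_bounded_compl:
  assumes "alt_bounded u w" shows "alt_bounded (compl_word u) (compl_word w)"
proof -
  have "[1, 0, 0] \<frown> compl_word u = compl_word ([0, 1, 1] \<frown> u)"
    "[0, 1, 1] \<frown> compl_word u = compl_word ([1, 0, 0] \<frown> u)"
    by (simp_all add: compl_word_build)
  then show ?thesis
    using assms unfolding alt_bounded_def by (simp only: suffix_compl_word compl_word_alt_le) simp
qed

section \<open>Runs of odd length\<close>

definition odd_one_run :: "int word \<Rightarrow> bool" where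
  "odd_one_run x \<longleftrightarrow> (\<exists>k. odd k \<and> (\<forall>i<k. x i = 1) \<and> x k = 0)"

text \<open>Let \<open>x\<close> first differ from \<open>z\<close> at \<open>j\<close>, and let the
  run of \<open>z\<close> end at the odd index \<open>k\<close>. If \<open>j < k\<close>, then
  \<open>z\<close> has a 1 at \<open>j\<close>, so \<open>x\<close> can be smaller only by a 0 at an
  odd \<open>j\<close>; \<open>j = k\<close> would need a letter below 0; if \<open>k < j\<close>,
  the runs coincide.\<close>

lemma odd_one_run_downward:
  assumes "x \<preceq>\<^sub>a\<^sub>l\<^sub>t z" "odd_one_run z" "binary_word x"
  shows "odd_one_run x"
proof (cases "x = z")
  case False
  then obtain j where j: "\<forall>i<j. x i = z i" "if even j then z j < x j else x j < z j"
    using assms(1) unfolding alt_le_iff by blast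
  obtain k where k: "odd k" "\<forall>i<k. z i = 1" "z k = 0"
    using assms(2) unfolding odd_one_run_def by blast
  have x: "x j = 0 \<or> x j = 1"
    using assms(3) by (simp add: binary_word_iff)
  consider "j < k" | "j = k" | "k < j"
    by linarith
  then show ?thesis
  proof cases
    case 1
    then have "odd j" "x j = 0"
      using j(2) k(2) x by (auto split: if_splits)
    with 1 j(1) k(2) show ?thesis
      unfolding odd_one_run_def by (intro exI[of _ j]) simp
  next
    case 2
    then show ?thesis using j(2) k(1,3) x by auto
  next
    case 3
    then show ?thesis
      using j(1) k unfolding odd_one_run_def by (intro exI[of _ k]) simp
  qed
qed (use assms in simp)

text \<open>At the odd index where the run of \<open>x\<close> ends, \<open>1 ## 1 ## x\<close>
  still has a 1. This is the first difference, and at an odd index the larger letter makes the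
  larger word.\<close>

lemma odd_one_run_not_le: 
  assumes "odd_one_run x" shows "\<not> 1 ## 1 ## x \<preceq>\<^sub>a\<^sub>l\<^sub>t x"
proof
  assume le: "1 ## 1 ## x \<preceq>\<^sub>a\<^sub>l\<^sub>t x"
  obtain k where k: "odd k" "\<forall>i<k. x i = 1" "x k = 0"
    using assms unfolding odd_one_run_def by blast
  have eq: "(1 ## 1 ## x) i = 1" if "i \<le> k" for i
    using that k by (auto simp: build_nth)
  then have "1 ## 1 ## x \<noteq> x"
    using k(3) by force
  then obtain j where j: "\<forall>i<j. (1 ## 1 ## x) i = x i"
    "if even j then x j < (1 ## 1 ## x) j else (1 ## 1 ## x) j < x j"
    using le unfolding alt_le_iff[of "1 ## 1 ## x"] by blast
  consider "j < k" | "j = k" | "k < j"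
    by linarith
  then show False
  proof cases
    case 1
    then show False using j(2) k(2) eq[of j] by (simp split: if_splits)
  next
    case 2
    then show False using j(2) k eq[of j] by simp
  next
    case 3
    then show False using j(1) k(3) eq[of k] by force
  qed
qed

text \<open>Words beginning with an odd run of ones form an initial segment of the alternate order.
  If one of them follows a 0, the lower bound puts \<open>u\<close> into this segment; the upper bound forces the
  run of zeros coming next to have length 2 and to be followed by some \<open>y \<preceq> u\<close>, and then the lower
  bound gives \<open>11u \<preceq> y \<preceq> u\<close>.\<close>

lemma alt_bounded_no_odd_one_run:
  assumes "binary_word w" "binary_word u" "alt_bounded u w" "w n = 0"
  shows "\<not> odd_one_run (suffix (Suc n) w)"
proof
  have lower: "1 ## 1 ## u \<preceq>\<^sub>a\<^sub>l\<^sub>t suffix (Suc m) w" if "w m = 0" for m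
    using assms that by (simp add: alt_bounded_iff)
  have upper: "suffix (Suc m) w \<preceq>\<^sub>a\<^sub>l\<^sub>t 0 ## 0 ## u" if "w m = 1" for m
    using assms that by (simp add: alt_bounded_iff)
  \<comment> \<open>The odd run of \<open>1 ## 1 ## u\<close> starts with the two added ones;
    removing them leaves an odd run of \<open>u\<close>.\<close>
  have below: "odd_one_run u" if "1 ## 1 ## u \<preceq>\<^sub>a\<^sub>l\<^sub>t z" "odd_one_run z" for z
  proof -
    have "binary_word (1 ## 1 ## u)"
      using assms(2) by (auto simp: binary_word_iff build_nth)
    with that have "odd_one_run (1 ## 1 ## u)"
      using odd_one_run_downward by blast
    then obtain k where k: "odd k" "\<forall>i<k. (1 ## 1 ## u) i = 1" "(1 ## 1 ## u) k = 0"
      unfolding odd_one_run_def by blast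
    have "k \<ge> 2"
      using k(3) by (auto simp: build_nth split: if_splits)
    then obtain j where j: "k = Suc (Suc j)"
      by (metis add_2_eq_Suc le_Suc_ex)
    have "u i = 1" if "i < j" for i
      using k(2)[rule_format, of "Suc (Suc i)"] that j by simp
    then show ?thesis
      using k j unfolding odd_one_run_def by auto
  qed
  assume run: "odd_one_run (suffix (Suc n) w)"
  then obtain k where k: "odd k" "\<forall>i<k. w (Suc n + i) = 1" "w (Suc n + k) = 0"
    unfolding odd_one_run_def by auto
  have u: "odd_one_run u"
    using below lower assms(4) run by blast
  have "w (n + k) = 1"
    using k(1) k(2)[rule_format, of "k - 1"] by (cases k) auto
  then have "suffix (Suc (n + k)) w \<preceq>\<^sub>a\<^sub>l\<^sub>t 0 ## 0 ## u"
    by (rule upper)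
  moreover define m where "m = n + k + 2"
  have "suffix (Suc (n + k)) w = 0 ## w m ## suffix (Suc m) w"
    using k(3) suffix_unfold[of "Suc (n + k)" w] suffix_unfold[of m w] by (simp add: m_def)
  ultimately have "w m \<le> 0" "w m = 0 \<Longrightarrow> suffix (Suc m) w \<preceq>\<^sub>a\<^sub>l\<^sub>t u"
    by (auto simp: alt_le_build simp del: suffix_singleton_suffix)
  moreover have "w m \<ge> 0"
    using assms(1)[unfolded binary_word_iff, rule_format, of m] by linarith
  ultimately have "1 ## 1 ## u \<preceq>\<^sub>a\<^sub>l\<^sub>t u"
    using lower[of m] alt_le_trans by auto
  with u show False
    using odd_one_run_not_le by blast
qed

lemma alt_bounded_even_run:
  assumes "binary_word w" "binary_word u" "alt_bounded u w"
    and "w n \<noteq> c" "\<And>i. i < k \<Longrightarrow> w (Suc n + i) = c" "w (Suc n + k) \<noteq> c"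
  shows "even k"
proof (rule ccontr)
  assume k: "odd k"
  have w: "w i = 0 \<or> w i = 1" for i
    using assms(1) by (simp add: binary_word_iff)
  have "c = 0 \<or> c = 1"
    using k assms(5)[of 0] w by (cases k) auto
  then show False
  proof
    assume "c = 1"
    then have "w n = 0" "odd_one_run (suffix (Suc n) w)"
      using assms(4-6) w k unfolding odd_one_run_def by (auto intro!: exI[of _ k])
    then show False
      using alt_bounded_no_odd_one_run assms(1-3) by blast
  next
    assume "c = 0"
    then have "compl_word w n = 0" "odd_one_run (suffix (Suc n) (compl_word w))"
      using assms(4-6) w k unfolding odd_one_run_def by (auto intro!: exI[of _ k])
    then show False
      using alt_bounded_no_odd_one_run[of "compl_word w" "compl_word u"] assms(1-3)
      by (simp add: alt_bounded_compl binary_word_compl)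
  qed
qed

text \<open>Position \<open>Suc l\<close> starts a new run. If a pair were broken, a run would end
  at its first position \<open>e\<close>. This run has even length, so the last position
  \<open>q\<close> before it is also the first one of an earlier pair; that pair is broken too,
  against the induction hypothesis.\<close>

lemma pairs_of_even_runs:
  assumes even: "\<And>n k c. w n \<noteq> c \<Longrightarrow> (\<And>i. i < k \<Longrightarrow> w (Suc n + i) = c) \<Longrightarrow> w (Suc n + k) \<noteq> c
      \<Longrightarrow> even k"
    and change: "w (Suc l) \<noteq> w l"
  shows "w (Suc l + 2 * j) = w (Suc l + 2 * j + 1)"
proof (induction j rule: less_induct)
  case (less j)
  show ?case
  proof (rule ccontr)
    define e where "e = Suc l + 2 * j"
    define Q where "Q = {q. q \<le> e \<and> w q \<noteq> w e}"
    assume "w (Suc l + 2 * j) \<noteq> w (Suc l + 2 * j + 1)"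
    then have end_run: "w (Suc e) \<noteq> w e"
      by (simp add: e_def)
    \<comment> \<open>As \<open>w l\<close> and \<open>w (Suc l)\<close> differ, one of them differs
      from \<open>w e\<close>. Hence \<open>Q\<close> is nonempty and its maximum is at least
      \<open>l\<close>.\<close>
    have "l \<in> Q \<or> Suc l \<in> Q"
      using change by (auto simp: Q_def e_def)
    moreover have fin: "finite Q"
      unfolding Q_def by simp
    ultimately have "Max Q \<in> Q" "l \<le> Max Q"
      using Max_in by (blast, meson Max_ge Suc_leD)
    define q where "q = Max Q"
    have q: "q < e" "w q \<noteq> w e" "l \<le> q"
      using \<open>Max Q \<in> Q\<close> \<open>l \<le> Max Q\<close> unfolding q_def Q_def by (auto simp: le_less)
    have after: "w i = w e" if "q < i" "i \<le> e" for i
      using that Max_ge[OF fin, of i] unfolding q_def Q_def by fastforce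
    have "even (e - q)"
    proof (rule even)
      show "w q \<noteq> w e" by (rule q)
      show "w (Suc q + i) = w e" if "i < e - q" for i
        using that by (intro after) auto
      show "w (Suc q + (e - q)) \<noteq> w e"
        using end_run q(1) by simp
    qed
    then obtain i where i: "e = q + 2 * i"
      using q(1) by (metis evenE le_add_diff_inverse less_imp_le)
    then have "i > 0"
      using q(1) by simp
    \<comment> \<open>From \<open>l \<le> q\<close> only \<open>2 * i \<le> 2 * j + 1\<close>
      follows; parity absorbs the extra 1.\<close>
    have "i \<le> j"
      using i q(3) by (simp add: e_def)
    then have "q = Suc l + 2 * (j - i)"
      using i by (simp add: e_def)
    then have "w (Suc q) = w q"
      using less.IH[of "j - i"] \<open>i > 0\<close> \<open>i \<le> j\<close> by simp
    then show False
      using after[of "Suc q"] q by simp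
  qed
qed

section \<open>Bounded words as a run followed by a doubled word\<close>

lemma suffix_double: "suffix (2 * n) (double s) = double (suffix n s)"
  by (rule ext) (simp add: double_def)

lemma double_suffix_unfold: "double (suffix n s) = s n ## s n ## double (suffix (Suc n) s)"
  by (metis double_build suffix_unfold)

lemma binary_word_suffix: "binary_word w \<Longrightarrow> binary_word (suffix n w)"
  by (simp add: binary_word_iff)

text \<open>The first run has no letter on its left, so its parity is free; after it all letters
  come in pairs. Cutting off the whole first run makes its letter differ from \<open>s 0\<close>,
  which starts the induction in \<open>alt_bounded_double_order\<close>.\<close>

lemma alt_bounded_imp_double:
  assumes "binary_word w" "binary_word u" "alt_bounded u w" "aperiodic w"
  obtains l s where "w = replicate (Suc l) (1 - s 0) \<frown> double s" "binary_word s" "aperiodic s"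
proof -
  have w: "w i = 0 \<or> w i = 1" for i
    using assms(1) by (simp add: binary_word_iff)
  have ex: "\<exists>l. w l \<noteq> w 0"
  proof (rule ccontr)
    assume "\<nexists>l. w l \<noteq> w 0"
    then have "w n = w m" for n m by metis
    then have "\<forall>n\<ge>1. w (n - 1) = w (n + 1 - 1)" by blast
    with assms(4) show False
      unfolding aperiodic_def by blast
  qed
  define p where "p = (LEAST l. w l \<noteq> w 0)"
  have p: "w p \<noteq> w 0" "\<And>i. i < p \<Longrightarrow> w i = w 0"
    using LeastI_ex[OF ex] not_less_Least unfolding p_def by blast+
  have "p \<noteq> 0"
    using p(1) by metis
  then obtain l where l: "p = Suc l"
    using not0_implies_Suc by blast
  define s where "s = (\<lambda>k. w (p + 2 * k))"
  have pairs: "w (Suc l + 2 * j) = w (Suc l + 2 * j + 1)" for j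
  proof (rule pairs_of_even_runs)
    show "even k" if "w n \<noteq> c" "\<And>i. i < k \<Longrightarrow> w (Suc n + i) = c" "w (Suc n + k) \<noteq> c" for n k c
      using assms(1-3) that by (rule alt_bounded_even_run)
    show "w (Suc l) \<noteq> w l"
      using p(1) p(2)[of l] l by simp
  qed
  have "double s k = w (p + k)" for k
    using pairs[of "k div 2"] unfolding double_def s_def l
    by (cases "even k") (auto elim!: evenE oddE)
  moreover have "w 0 = 1 - s 0"
    using p(1) w[of p] w[of 0] unfolding s_def by (metis add_0_right diff_0_right diff_self mult_0_right)
  then have "w i = 1 - s 0" if "i < p" for i
    using p(2)[OF that] by simp
  ultimately have eq: "w = replicate (Suc l) (1 - s 0) \<frown> double s"
    by (intro ext) (simp add: conc_def l less_Suc_eq_le del: replicate.simps)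
  have "binary_word s"
    using w by (simp add: s_def binary_word_iff)
  moreover have "aperiodic s"
    unfolding aperiodic_def
  proof (rule notI, elim exE conjE)
    fix k N :: nat
    assume k: "k \<ge> 1" "N \<ge> 1" "\<forall>n\<ge>N. s (n - 1) = s (n + k - 1)"
    \<comment> \<open>The threshold makes \<open>(n - 1 - p) div 2\<close> at least
      \<open>N\<close>; a period \<open>k\<close> of \<open>s\<close> becomes the period
      \<open>2 * k\<close> of \<open>w\<close>.\<close>
    have "w (n - 1) = w (n + 2 * k - 1)" if "n \<ge> Suc p + 2 * N" for n
    proof -
      define m where "m = n - 1 - p"
      have m: "n - 1 = p + m" "n + 2 * k - 1 = p + (m + 2 * k)" "m div 2 \<ge> N"
        using that by (auto simp: m_def)
      then have "s (m div 2) = s (m div 2 + k)"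
        using k(3)[rule_format, of "Suc (m div 2)"] by simp
      then show ?thesis
        using \<open>\<And>k. double s k = w (p + k)\<close>[of m] \<open>\<And>k. double s k = w (p + k)\<close>[of "m + 2 * k"]
        unfolding m double_def by (simp add: add.commute)
    qed
    moreover have "2 * k \<ge> 1" "Suc p + 2 * N \<ge> 1"
      using k(1) by simp_all
    ultimately show False
      using assms(4) unfolding aperiodic_def by blast
  qed
  ultimately show ?thesis
    using that eq by blast
qed

text \<open>If the letter of \<open>w\<close> before the pair \<open>s n\<close> differs from
  \<open>s n\<close>, the bound at that letter applies, and cancelling the pair reverses the order
  twice. If it equals \<open>s n\<close>, the claim for the previous pair is passed on, because
  removing a leading 0 or 1 moves the word in the right direction.\<close>

lemma alt_bounded_double_order:
  assumes w: "w = replicate (Suc l) (1 - s 0) \<frown> double s"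
    and "binary_word w" "binary_word s" "alt_bounded u w"
  shows "(s n = 0 \<longrightarrow> double (suffix (Suc n) s) \<preceq>\<^sub>a\<^sub>l\<^sub>t u) \<and> 
         (s n = 1 \<longrightarrow> u \<preceq>\<^sub>a\<^sub>l\<^sub>t double (suffix (Suc n) s))"
proof -
  have suffix: "suffix (Suc l) w = double s"
    unfolding w by (metis length_replicate suffix_conc_length)
  then have suffix_even: "suffix (Suc l + 2 * n) w = s n ## s n ## double (suffix (Suc n) s)" for n
    by (metis double_suffix_unfold suffix_double suffix_suffix)
  have below: "double (suffix (Suc n) s) \<preceq>\<^sub>a\<^sub>l\<^sub>t u" if "w (l + 2 * n) = 1" "s n = 0" for n
    using assms that suffix_even[of n] by (auto simp: alt_bounded_iff alt_le_build dest!: spec[of _ "l + 2 * n"])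
  have above: "u \<preceq>\<^sub>a\<^sub>l\<^sub>t double (suffix (Suc n) s)" if "w (l + 2 * n) = 0" "s n = 1" for n
    using assms that suffix_even[of n] by (auto simp: alt_bounded_iff alt_le_build dest!: spec[of _ "l + 2 * n"])
  show ?thesis
  proof (induction n)
    case 0
    have "w l = 1 - s 0"
      unfolding w by (subst conc_fst) (auto simp del: replicate.simps)
    then show ?case
      using below[of 0] above[of 0] by (metis add_0_right diff_0_right diff_self mult_0_right)
  next
    case (Suc n)
    \<comment> \<open>Index \<open>l + 2 * Suc n\<close> is \<open>Suc l + 2 * n + 1\<close>, the
      second letter of the pair \<open>s n\<close>.\<close>
    have "w (l + 2 * Suc n) = suffix (Suc l + 2 * n) w 1"
      by simp
    then have wn: "w (l + 2 * Suc n) = s n"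
      unfolding suffix_even by simp
    have unfold: "suffix (Suc n) s = s (Suc n) ## suffix (Suc (Suc n)) s"
      by (rule suffix_unfold)
    have bin: "binary_word (suffix (Suc (Suc n)) s)"
      using assms(3) by (rule binary_word_suffix)
    have sn: "s n = 0 \<or> s n = 1"
      using assms(3) by (simp add: binary_word_iff)
    show ?case
    proof (intro conjI impI)
      assume 0: "s (Suc n) = 0"
      show "double (suffix (Suc (Suc n)) s) \<preceq>\<^sub>a\<^sub>l\<^sub>t u"
        using sn
      proof
        assume "s n = 0"
        moreover have "double (suffix (Suc (Suc n)) s) \<preceq>\<^sub>a\<^sub>l\<^sub>t double (suffix (Suc n) s)"
          unfolding unfold 0 by (intro double_antimono zero_build_lex_le bin)
        ultimately show ?thesis
          using Suc alt_le_trans by blast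
      qed (use below wn 0 in simp)
    next
      assume 1: "s (Suc n) = 1"
      show "u \<preceq>\<^sub>a\<^sub>l\<^sub>t double (suffix (Suc (Suc n)) s)"
        using sn
      proof
        assume "s n = 1"
        moreover have "double (suffix (Suc n) s) \<preceq>\<^sub>a\<^sub>l\<^sub>t double (suffix (Suc (Suc n)) s)"
          unfolding unfold 1 by (intro double_antimono one_build_lex_le bin)
        ultimately show ?thesis
          using Suc alt_le_trans by blast
      qed (use above wn 1 in simp)
    qed
  qed
qed

section \<open>Balanced words and their slope\<close>

abbreviation window_sum :: "int word \<Rightarrow> nat \<Rightarrow> nat \<Rightarrow> int" where
  "window_sum s n k \<equiv> (\<Sum>i<k. s (n + i))"

lemma window_sum_add: "window_sum s n (j + k) = window_sum s n j + window_sum s (n + j) k"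
  by (induction k) (simp_all add: add.assoc)

lemma window_sum_bounds:
  assumes "binary_word s" shows "0 \<le> window_sum s n k" "window_sum s n k \<le> int k"
proof -
  have s: "0 \<le> s i" "s i \<le> 1" for i
    using assms[unfolded binary_word_iff, rule_format, of i] by linarith+
  then show "0 \<le> window_sum s n k"
    by (simp add: sum_nonneg)
  show "window_sum s n k \<le> int k"
    using sum_bounded_above[of "{..<k}" "\<lambda>i. s (n + i)" 1] s by simp
qed

definition balanced :: "int word \<Rightarrow> bool" where
  "balanced s \<longleftrightarrow> (\<forall>m n k. window_sum s m k \<le> window_sum s n k + 1)"

text \<open>A shortest pair of windows violating balance has the form \<open>1p1\<close>, \<open>0p0\<close>.\<close>

lemma order_imp_balanced:
  assumes "binary_word s"
    and order: "\<And>n m. s n = 1 \<Longrightarrow> s m = 0 \<Longrightarrow> lex_le (suffix (Suc n) s) (suffix (Suc m) s)"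
  shows "balanced s"
proof (rule ccontr)
  assume "\<not> balanced s"
  define bad where "bad = (\<lambda>k. \<exists>m n. window_sum s m k > window_sum s n k + 1)"
  have "\<exists>k. bad k"
    using \<open>\<not> balanced s\<close> unfolding balanced_def bad_def by (meson not_less)
  define k where "k = (LEAST k. bad k)"
  have "bad k" and least: "\<And>j. j < k \<Longrightarrow> \<not> bad j"
    using LeastI_ex[OF \<open>\<exists>k. bad k\<close>] not_less_Least unfolding k_def by blast+
  then obtain m n where mn: "window_sum s m k > window_sum s n k + 1"
    unfolding bad_def by blast
  have s: "s i = 0 \<or> s i = 1" for i
    using assms(1) by (simp add: binary_word_iff)
  \<comment> \<open>Minimality of \<open>k\<close> bounds \<open>d j\<close> from above through the
    prefixes of length \<open>j\<close> and from below through the remaining windows of length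
    \<open>k - j\<close>. So \<open>d\<close> is 1 strictly between 0 and \<open>k\<close>: the
    windows differ only in their first and last letters.\<close>
  define d where "d = (\<lambda>j. window_sum s m j - window_sum s n j)"
  have d_Suc: "d (Suc j) = d j + (s (m + j) - s (n + j))" for j
    by (simp add: d_def)
  have "d 0 = 0" "d k \<ge> 2"
    using mn by (simp_all add: d_def)
  have d_le: "d j \<le> 1" if "j < k" for j
    using least[OF that] unfolding bad_def d_def by (simp add: not_less) (metis add.commute diff_le_eq)
  have d_ge: "d j \<ge> 1" if "0 < j" "j < k" for j
  proof -
    have "window_sum s (m + j) (k - j) \<le> window_sum s (n + j) (k - j) + 1"
      using least[of "k - j"] that unfolding bad_def by (simp add: not_less)
    then have "d k \<le> d j + 1"
      using window_sum_add[of s m j "k - j"] window_sum_add[of s n j "k - j"] that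
      unfolding d_def by simp
    then show ?thesis using \<open>d k \<ge> 2\<close> by simp
  qed
  have "k > 0"
    using \<open>d 0 = 0\<close> \<open>d k \<ge> 2\<close> by (cases k) auto
  then have d_last: "d (k - 1) = 1" "s (m + (k - 1)) = 1" "s (n + (k - 1)) = 0"
    using d_Suc[of "k - 1"] d_le[of "k - 1"] s[of "m + (k - 1)"] s[of "n + (k - 1)"] \<open>d k \<ge> 2\<close>
    by auto
  then have "k \<noteq> 1"
    using \<open>d 0 = 0\<close> by auto
  with \<open>k > 0\<close> have "k \<ge> 2"
    by simp
  have d_mid: "d j = 1" if "0 < j" "j < k" for j
    using d_le[of j] d_ge[of j] that by linarith
  have "s m - s n = 1"
    using d_mid[of 1] d_Suc[of 0] \<open>d 0 = 0\<close> \<open>k \<ge> 2\<close> by simp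
  then have "s m = 1" "s n = 0"
    using s[of m] s[of n] by linarith+
  then have le: "lex_le (suffix (Suc m) s) (suffix (Suc n) s)"
    by (rule order)
  have agree: "suffix (Suc m) s i = suffix (Suc n) s i" if "i < k - 2" for i
    using d_mid[of "Suc i"] d_mid[of "Suc (Suc i)"] d_Suc[of "Suc i"] that by simp
  have idx: "Suc m + (k - 2) = m + (k - 1)" "Suc n + (k - 2) = n + (k - 1)"
    using \<open>k \<ge> 2\<close> by simp_all
  have "suffix (Suc m) s (k - 2) = 1" "suffix (Suc n) s (k - 2) = 0"
    unfolding suffix_nth idx by (fact d_last)+
  with agree have "less_fun (suffix (Suc n) s) (suffix (Suc m) s)"
    by (intro less_funI exI[of _ "k - 2"]) simp
  with le show False
    using less_fun_asym less_fun_irrefl unfolding lex_le_def by metis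
qed

text \<open>A block of length \<open>m * n\<close> is cut into \<open>m\<close> windows of length
  \<open>n\<close> and also into \<open>n\<close> windows of length \<open>m\<close>; balance
  compares each piece with the window at \<open>i\<close> or at \<open>j\<close>.\<close>

lemma balanced_imp_mult_le:
  assumes "balanced s"
  shows "int m * (window_sum s i n - 1) \<le> int n * (window_sum s j m + 1)"
proof -
  have lower: "int m * (window_sum s i n - 1) \<le> window_sum s a (m * n)" for a
  proof (induction m)
    case (Suc m)
    have "window_sum s a (Suc m * n) = window_sum s a (m * n) + window_sum s (a + m * n) n"
      using window_sum_add[of s a "m * n" n] by (simp add: add.commute)
    moreover have "window_sum s i n \<le> window_sum s (a + m * n) n + 1"
      using assms unfolding balanced_def by blast
    ultimately show ?case
      using Suc by (simp add: algebra_simps)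
  qed simp
  have upper: "window_sum s a (n * m) \<le> int n * (window_sum s j m + 1)" for a
  proof (induction n)
    case (Suc n)
    have "window_sum s a (Suc n * m) = window_sum s a (n * m) + window_sum s (a + n * m) m"
      using window_sum_add[of s a "n * m" m] by (simp add: add.commute)
    moreover have "window_sum s (a + n * m) m \<le> window_sum s j m + 1"
      using assms unfolding balanced_def by blast
    ultimately show ?case
      using Suc by (simp add: algebra_simps)
  qed simp
  show ?thesis
    using lower[of 0] upper[of 0] by (simp add: mult.commute)
qed

text \<open>By \<open>balanced_imp_mult_le\<close>, every lower estimate (sum minus 1, over length)
  is at most every upper estimate (sum plus 1, over length). The supremum of the lower ones
  separates the two families.\<close>

lemma balanced_slope:
  assumes "balanced s"
  obtains \<theta> :: real where "\<And>n k. \<bar>of_int (window_sum s n k) - real k * \<theta>\<bar> \<le> 1"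
proof -
  define low where "low = (\<lambda>(i, n). (of_int (window_sum s i n) - 1) / real n) ` (UNIV \<times> {1..})"
  have le: "(of_int (window_sum s i n) - 1) / real n \<le> (of_int (window_sum s j m) + 1) / real m"
    if "n \<ge> 1" "m \<ge> 1" for i j n m
  proof -
    have "real_of_int (int m * (window_sum s i n - 1)) \<le> real_of_int (int n * (window_sum s j m + 1))"
      using balanced_imp_mult_le[OF assms] by (simp only: of_int_le_iff)
    then show ?thesis
      using that by (simp add: field_simps)
  qed
  define \<theta> where "\<theta> = Sup low"
  have upper: "x \<le> (of_int (window_sum s j m) + 1) / real m" if "x \<in> low" "m \<ge> 1" for x j m
    using that le unfolding low_def by auto
  have "low \<noteq> {}"
    unfolding low_def by auto
  then have le_upper: "\<theta> \<le> (of_int (window_sum s j m) + 1) / real m" if "m \<ge> 1" for j m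
    unfolding \<theta>_def using upper that by (intro cSup_least) auto
  have "bdd_above low"
    using upper[of _ 1 0] by (auto simp: bdd_above_def)
  then have ge_lower: "(of_int (window_sum s i n) - 1) / real n \<le> \<theta>" if "n \<ge> 1" for i n
    unfolding \<theta>_def using that by (intro cSup_upper) (auto simp: low_def)
  have "\<bar>of_int (window_sum s n k) - real k * \<theta>\<bar> \<le> 1" if "k \<ge> 1" for n k
  proof -
    have "real k * \<theta> \<le> of_int (window_sum s n k) + 1" "of_int (window_sum s n k) - 1 \<le> real k * \<theta>"
      using that le_upper[of k n] ge_lower[of k n]
      by (simp_all add: le_divide_eq divide_le_eq mult.commute)
    then show ?thesis by linarith
  qed
  then have "\<bar>of_int (window_sum s n k) - real k * \<theta>\<bar> \<le> 1" for n k
    by (cases "k = 0") simp_all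
  then show ?thesis
    by (rule that)
qed

section \<open>Aperiodic balanced words are Sturmian\<close>

lemma window_sum_Suc_shift: "window_sum s (Suc n) k - window_sum s n k = s (n + k) - s n"
  using window_sum_add[of s n 1 k] by simp

lemma window_sum_double_count:
  "(\<Sum>i<N. window_sum s i q) = (\<Sum>r<q. window_sum s r N)"
  by (subst sum.swap) (simp add: add.commute)

text \<open>For slope \<open>p/q\<close>, balance gives all deviations \<open>g i\<close> of windows
  of length \<open>q\<close> from \<open>p\<close> the same sign. Double counting bounds their
  partial sums by \<open>q\<close>, so only finitely many are nonzero. Once they vanish, consecutive
  windows have equal sums, which makes \<open>q\<close> a period.\<close>

lemma aperiodic_slope_irrational:
  assumes "aperiodic s" "balanced s"
    and slope: "\<And>n k. \<bar>of_int (window_sum s n k) - real k * \<theta>\<bar> \<le> 1"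
  shows "\<theta> \<notin> \<rat>"
proof
  assume "\<theta> \<in> \<rat>"
  then obtain p b where b: "b > 0" "\<theta> = of_int p / of_int b"
    by (metis Rats_cases')
  define q where "q = nat b"
  have q: "q > 0" "real q * \<theta> = of_int p"
    using b by (simp_all add: q_def)
  define g where "g = (\<lambda>i. window_sum s i q - p)"
  have same_sign: "(\<forall>i. g i \<ge> 0) \<or> (\<forall>i. g i \<le> 0)"
  proof (rule ccontr)
    assume "\<not> ?thesis"
    then obtain i j where "g i < 0" "g j > 0"
      by (auto simp: not_le)
    moreover have "window_sum s j q \<le> window_sum s i q + 1"
      using assms(2) unfolding balanced_def by blast
    ultimately show False
      by (simp add: g_def)
  qed
  have total: "\<bar>\<Sum>i<N. g i\<bar> \<le> int q" for N
  proof -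
    have "real_of_int (\<Sum>i<N. g i) = (\<Sum>r<q. of_int (window_sum s r N)) - real N * of_int p"
      unfolding g_def sum_subtractf window_sum_double_count by simp
    also have "\<dots> = (\<Sum>r<q. of_int (window_sum s r N) - real N * \<theta>)"
      unfolding sum_subtractf by (simp add: q(2)[symmetric])
    also have "\<bar>\<dots>\<bar> \<le> (\<Sum>r<q. 1)"
      by (rule order_trans[OF sum_abs]) (intro sum_mono slope)
    also have "\<dots> = real_of_int (int q)"
      by simp
    finally show ?thesis
      by (simp only: of_int_le_iff of_int_abs[symmetric])
  qed
  have abs_total: "(\<Sum>i<N. \<bar>g i\<bar>) = \<bar>\<Sum>i<N. g i\<bar>" for N
    using same_sign
  proof
    assume "\<forall>i. g i \<ge> 0"
    then show ?thesis by (simp add: sum_nonneg)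
  next
    assume "\<forall>i. g i \<le> 0"
    then have "(\<Sum>i<N. \<bar>g i\<bar>) = - (\<Sum>i<N. g i)" "(\<Sum>i<N. g i) \<le> 0"
      by (simp_all add: sum_negf sum_nonpos)
    then show ?thesis by simp
  qed
  have bound: "(\<Sum>i<N. nat \<bar>g i\<bar>) \<le> q" for N
  proof -
    have "int (\<Sum>i<N. nat \<bar>g i\<bar>) \<le> int q"
      using total[of N] abs_total[of N] by simp
    then show ?thesis
      by (simp only: of_nat_le_iff)
  qed
  \<comment> \<open>\<open>M\<close> maximizes the bounded partial sums, so every later term is
    zero.\<close>
  obtain M where M: "(\<Sum>i<N. nat \<bar>g i\<bar>) \<le> (\<Sum>i<M. nat \<bar>g i\<bar>)" for N
    using ex_has_greatest_nat[of "\<lambda>_. True" 0 "\<lambda>N. \<Sum>i<N. nat \<bar>g i\<bar>" "Suc q"] bound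
    by (auto simp: less_Suc_eq_le)
  have "g i = 0" if "i \<ge> M" for i
  proof -
    have "(\<Sum>i<M. nat \<bar>g i\<bar>) + nat \<bar>g i\<bar> \<le> (\<Sum>i<i. nat \<bar>g i\<bar>) + nat \<bar>g i\<bar>"
      using that by (intro add_right_mono sum_mono2) auto
    also have "\<dots> \<le> (\<Sum>i<M. nat \<bar>g i\<bar>)"
      using M[of "Suc i"] by simp
    finally show ?thesis by simp
  qed
  then have period: "s i = s (i + q)" if "i \<ge> M" for i
    using that window_sum_Suc_shift[of s i q] unfolding g_def
    by (metis eq_iff_diff_eq_0 le_Suc_eq)
  have "s (n - 1) = s (n + q - 1)" if "n \<ge> Suc M" for n
    using that period[of "n - 1"] by simp
  moreover have "q \<ge> 1" "Suc M \<ge> 1"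
    using q(1) by simp_all
  ultimately show False
    using assms(1) unfolding aperiodic_def by blast
qed

text \<open>The deviations \<open>e n\<close> of the prefix sums lie between
  \<open>\<rho> - 1\<close> and \<open>\<rho>\<close>. If the lower end is not attained, the prefix
  sums are floors of \<open>n * \<theta> + \<rho>\<close>; otherwise the upper end is not attained
  and they are ceilings with intercept \<open>\<rho> - 1\<close>.\<close>

lemma slope_imp_sturmian:
  assumes "binary_word s" "\<theta> \<notin> \<rat>"
    and slope: "\<And>n k. \<bar>of_int (window_sum s n k) - real k * \<theta>\<bar> \<le> 1"
  shows "sturmian s"
proof -
  define P where "P = window_sum s 0"
  have s: "s (n - 1) = P n - P (n - 1)" if "n \<ge> 1" for n
    using that by (cases n) (simp_all add: P_def)
  define e where "e = (\<lambda>n. of_int (P n) - real n * \<theta>)"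
  have e_diff: "\<bar>e (n + k) - e n\<bar> \<le> 1" for n k
    using slope[of n k] window_sum_add[of s 0 n k]
    by (simp add: e_def P_def algebra_simps del: of_int_sum)
  have e_le: "e m \<le> e n + 1" for m n
    using e_diff[of n "m - n"] e_diff[of m "n - m"] by (cases "n \<le> m") auto
  define \<rho> where "\<rho> = Sup (range e)"
  have "bdd_above (range e)"
    using e_le[of _ 0] by (auto simp: bdd_above_def)
  then have lower: "e n \<le> \<rho>" for n
    unfolding \<rho>_def by (intro cSup_upper) auto
  have upper: "\<rho> \<le> e n + 1" for n
    unfolding \<rho>_def using e_le by (intro cSup_least) auto
  have "\<theta> \<ge> 0"
  proof (rule ccontr)
    assume "\<not> \<theta> \<ge> 0"
    then obtain k where "1 < real k * (- \<theta>)"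
      using reals_Archimedean3[of "- \<theta>"] by (meson neg_0_less_iff_less not_le)
    then show False
      using slope[of 0 k] window_sum_bounds(1)[OF assms(1), of 0 k] by linarith
  qed
  have "\<theta> \<le> 1"
  proof (rule ccontr)
    assume "\<not> \<theta> \<le> 1"
    then obtain k where "1 < real k * (\<theta> - 1)"
      using reals_Archimedean3[of "\<theta> - 1"] by (meson diff_gt_0_iff_gt not_le)
    then show False
      using slope[of 0 k] window_sum_bounds(2)[OF assms(1), of 0 k]
      unfolding right_diff_distrib by linarith
  qed
  have "\<theta> \<noteq> 0" "\<theta> \<noteq> 1"
    using assms(2) by auto
  with \<open>\<theta> \<ge> 0\<close> \<open>\<theta> \<le> 1\<close> have \<theta>: "0 < \<theta>" "\<theta> < 1"
    by simp_all
  \<comment> \<open>The letter \<open>s (n - 1)\<close> is \<open>P n - P (n - 1)\<close>, while the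
    definition of Sturmian words uses \<open>n + 1\<close> and \<open>n\<close>; the intercept is
    lowered by \<theta> to compensate.\<close>
  have shift: "real (n + 1) * \<theta> + (\<sigma> - \<theta>) = real n * \<theta> + \<sigma>"
    "n \<ge> 1 \<Longrightarrow> real n * \<theta> + (\<sigma> - \<theta>) = real (n - 1) * \<theta> + \<sigma>" for n \<sigma>
    by (simp_all add: algebra_simps of_nat_diff)
  show ?thesis
  proof (cases "\<exists>n. \<rho> = e n + 1")
    case False
    then have "\<rho> < e n + 1" for n
      using upper[of n] by (metis order_le_less)
    then have "P n = \<lfloor>real n * \<theta> + \<rho>\<rfloor>" for n
      using lower[of n] by (intro floor_unique[symmetric]) (simp_all add: e_def algebra_simps)
    then have "s (n - 1) = \<lfloor>real (n + 1) * \<theta> + (\<rho> - \<theta>)\<rfloor> - \<lfloor>real n * \<theta> + (\<rho> - \<theta>)\<rfloor>"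
      if "n \<ge> 1" for n
      unfolding shift(1) shift(2)[OF that] using s[OF that] by (simp only:)
    then show ?thesis
      unfolding sturmian_def using assms \<theta> by blast
  next
    case True
    then obtain n0 where n0: "\<rho> = e n0 + 1"
      by blast
    \<comment> \<open>Attaining both ends would make a nonzero integer multiple of \<theta> an
      integer.\<close>
    have "e n \<noteq> \<rho>" for n
    proof
      assume "e n = \<rho>"
      then have eq: "(real n - real n0) * \<theta> = of_int (P n - P n0 - 1)"
        by (simp add: n0 e_def algebra_simps)
      have "n \<noteq> n0"
        using n0 \<open>e n = \<rho>\<close> by auto
      then have "\<theta> = of_int (P n - P n0 - 1) / of_int (int n - int n0)"
        using eq by (simp add: field_simps)
      then have "\<theta> \<in> \<rat>"
        by (metis Rats_divide Rats_of_int)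
      with assms(2) show False by simp
    qed
    then have "e n < \<rho>" for n
      using lower[of n] by (metis order_le_less)
    then have "P n = \<lceil>real n * \<theta> + (\<rho> - 1)\<rceil>" for n
      using upper[of n] by (intro ceiling_unique[symmetric]) (simp_all add: e_def algebra_simps)
    then have "s (n - 1) =
        \<lceil>real (n + 1) * \<theta> + (\<rho> - 1 - \<theta>)\<rceil> - \<lceil>real n * \<theta> + (\<rho> - 1 - \<theta>)\<rceil>"
      if "n \<ge> 1" for n
      unfolding shift(1) shift(2)[OF that] using s[OF that] by (simp only:)
    then show ?thesis
      unfolding sturmian_def using assms \<theta> by blast
  qed
qed

lemma aperiodic_balanced_imp_sturmian:
  assumes "binary_word s" "aperiodic s" "balanced s"
  shows "sturmian s"
  using balanced_slope[OF assms(3)] aperiodic_slope_irrational[OF assms(2,3)]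
    slope_imp_sturmian[OF assms(1)] by metis

section \<open>Window sums of Sturmian words as differences of roundings\<close>

lemma sturmian_window_sum:
  assumes "sturmian s"
  obtains \<theta> :: real and F :: "real \<Rightarrow> int" and \<rho> :: real where
    "\<theta> \<notin> \<rat>" "0 < \<theta>" "\<theta> < 1" "F = floor \<or> F = ceiling"
    "\<And>n k. window_sum s n k = F (real (n + k) * \<theta> + \<rho>) - F (real n * \<theta> + \<rho>)"
proof -
  obtain \<theta> \<sigma> where \<theta>: "\<theta> \<notin> \<rat>" "0 < \<theta>" "\<theta> < 1" and *:
    "(\<forall>n\<ge>1. s (n - 1) = \<lfloor>real (n + 1) * \<theta> + \<sigma>\<rfloor> - \<lfloor>real n * \<theta> + \<sigma>\<rfloor>) \<or>
     (\<forall>n\<ge>1. s (n - 1) = \<lceil>real (n + 1) * \<theta> + \<sigma>\<rceil> - \<lceil>real n * \<theta> + \<sigma>\<rceil>)"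
    using assms unfolding sturmian_def by blast
  then obtain F :: "real \<Rightarrow> int" where F: "F = floor \<or> F = ceiling"
    and s: "\<And>n. n \<ge> 1 \<Longrightarrow> s (n - 1) = F (real (n + 1) * \<theta> + \<sigma>) - F (real n * \<theta> + \<sigma>)"
    by metis
  \<comment> \<open>Windows start at 0 and the definition at 1, so the intercept grows by \<theta>;
    the sum then telescopes.\<close>
  have shift: "real (Suc n) * \<theta> + \<sigma> = real n * \<theta> + (\<theta> + \<sigma>)" for n
    by (simp add: algebra_simps)
  have s_nth: "s n = F (real (Suc n) * \<theta> + (\<theta> + \<sigma>)) - F (real n * \<theta> + (\<theta> + \<sigma>))" for n
    using s[of "Suc n"] shift[of n] shift[of "Suc n"] by (simp only: diff_Suc_1 Suc_eq_plus1) simp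
  have "window_sum s n k = F (real (n + k) * \<theta> + (\<theta> + \<sigma>)) - F (real n * \<theta> + (\<theta> + \<sigma>))" for n k
  proof (induction k)
    case (Suc k)
    then show ?case
      using s_nth[of "n + k"] by (simp only: sum.lessThan_Suc add_Suc_right)
  qed simp
  with \<theta> F show ?thesis
    by (rule that)
qed

lemma floor_ceiling_diff_bounds:
  fixes a b :: real
  assumes "F = floor \<or> F = ceiling"
  shows "\<lfloor>b\<rfloor> \<le> F (a + b) - F a" "F (a + b) - F a \<le> \<lceil>b\<rceil>"
  using assms by (safe; linarith)+

text \<open>Up to the first difference the prefix sums agree, so the next prefix sum decides between
  the differing letters.\<close>

lemma lex_le_window_sum:
  assumes "\<And>k. window_sum v 0 k \<le> window_sum w 0 k"
  shows "lex_le v w"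
proof (cases "v = w")
  case False
  then obtain k where k: "\<forall>i<k. v i = w i" "v k \<noteq> w k"
    by (rule first_difference)
  moreover have "window_sum v 0 k = window_sum w 0 k"
    using k(1) by simp
  then have "v k \<le> w k"
    using assms[of "Suc k"] by simp
  ultimately show ?thesis
    unfolding lex_le_iff by (metis order_le_less)
qed (simp add: lex_le_iff)

lemma window_sum_build: "window_sum (a ## w) 0 (Suc k) = a + window_sum w 0 k"
  by (subst sum.lessThan_Suc_shift) simp

lemma window_sum_suffix: "window_sum (suffix n s) 0 k = window_sum s n k"
  by simp

lemma ceiling_irrational: "x \<notin> \<rat> \<Longrightarrow> \<lceil>x\<rceil> = \<lfloor>x\<rfloor> + 1" for x :: real
  unfolding ceiling_altdef by (metis Rats_of_int)

section \<open>The characteristic word and the multiples of \<theta> modulo 1\<close>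

context
  fixes \<theta> :: real
  assumes \<theta>: "\<theta> \<notin> \<rat>" "0 < \<theta>" "\<theta> < 1"
begin

lemma mult_irrational: "real (Suc k) * \<theta> \<notin> \<rat>"
proof
  assume "real (Suc k) * \<theta> \<in> \<rat>"
  then have "real (Suc k) * \<theta> / real (Suc k) \<in> \<rat>"
    by (intro Rats_divide Rats_of_nat)
  then show False
    using \<theta>(1) by simp
qed

lemma floor_slope: "\<lfloor>\<theta>\<rfloor> = 0" "\<lfloor>- \<theta>\<rfloor> = -1" "\<lceil>- \<theta>\<rceil> = 0"
  using \<theta>(2,3) by linarith+

lemma window_sum_char: "window_sum (char_sturmian \<theta>) 0 k = \<lfloor>real (Suc k) * \<theta>\<rfloor>"
proof (induction k)
  case 0
  then show ?case using floor_slope by simp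
next
  case (Suc k)
  have "real (k + 2) = real (Suc (Suc k))" "real (k + 1) = real (Suc k)"
    by simp_all
  then have "char_sturmian \<theta> k = \<lfloor>real (Suc (Suc k)) * \<theta>\<rfloor> - \<lfloor>real (Suc k) * \<theta>\<rfloor>"
    unfolding char_sturmian_def by (simp only:)
  with Suc show ?case
    by (simp only: sum.lessThan_Suc add_0)
qed

lemma window_sum_zero_char: "window_sum (0 ## char_sturmian \<theta>) 0 k = \<lfloor>real k * \<theta>\<rfloor>"
  by (cases k) (simp, simp only: window_sum_build window_sum_char)

text \<open>By irrationality, ceiling and floor of \<open>k * \<theta>\<close> differ by one except
  at \<open>k = 0\<close>; the difference is the leading 1.\<close>

lemma window_sum_one_char: "window_sum (1 ## char_sturmian \<theta>) 0 k = \<lceil>real k * \<theta>\<rceil>"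
  by (cases k) (simp, simp only: window_sum_build window_sum_char ceiling_irrational[OF mult_irrational])

text \<open>The subtraction is real: at \<open>k = 0\<close> the formula reads
  \<open>\<lfloor>- \<theta>\<rfloor> + 1\<close>, which is 0.\<close>

lemma window_sum_one_zero_char:
  "window_sum (1 ## 0 ## char_sturmian \<theta>) 0 k = \<lfloor>(real k - 1) * \<theta>\<rfloor> + 1"
proof (cases k)
  case (Suc j)
  then show ?thesis
    unfolding Suc window_sum_build window_sum_zero_char by simp
qed (use floor_slope in simp)

lemma window_sum_zero_one_char:
  "window_sum (0 ## 1 ## char_sturmian \<theta>) 0 k = \<lceil>(real k - 1) * \<theta>\<rceil>"
proof (cases k)
  case (Suc j)
  then show ?thesis
    unfolding Suc window_sum_build window_sum_one_char by simp
qed (use floor_slope in simp)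

lemma binary_word_char_sturmian: "binary_word (char_sturmian \<theta>)"
proof -
  have "\<lfloor>real (n + 2) * \<theta>\<rfloor> - \<lfloor>real (n + 1) * \<theta>\<rfloor> \<in> {0, 1}" for n
  proof -
    have "real (n + 2) * \<theta> = real (n + 1) * \<theta> + \<theta>"
      by (simp add: algebra_simps)
    then show ?thesis
      using floor_ceiling_diff_bounds[where F = floor and a = "real (n + 1) * \<theta>" and b = \<theta>]
        ceiling_irrational[OF \<theta>(1)] floor_slope(1) by auto
  qed
  then show ?thesis
    unfolding binary_word_def char_sturmian_def by (intro image_subsetI)
qed

lemma dense_above_integer:
  assumes "\<epsilon> > 0"
  obtains n M where "0 < real (Suc n) * \<theta> + \<rho> - of_int M" "real (Suc n) * \<theta> + \<rho> - of_int M < \<epsilon>"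
proof -
  \<comment> \<open>Approximating this target within \<open>\<epsilon> / 2\<close> puts the point,
    after adding \<rho>, within \<open>\<epsilon> / 2\<close> of an integer plus
    \<open>\<epsilon> / 2\<close>, hence strictly above that integer.\<close>
  define \<alpha> where "\<alpha> = frac (\<epsilon> / 2 - \<rho>)"
  obtain k where k: "k > 0" "\<bar>frac (real k * \<theta>) - \<alpha>\<bar> < \<epsilon> / 2"
    using Kronecker_approx_1_explicit[OF \<theta>(1), of \<alpha> "\<epsilon> / 2"] assms
    by (auto simp: \<alpha>_def less_imp_le[OF frac_lt_1])
  then obtain n where n: "k = Suc n"
    by (metis gr0_implies_Suc)
  have "\<bar>real (Suc n) * \<theta> + \<rho> - of_int (\<lfloor>real (Suc n) * \<theta>\<rfloor> - \<lfloor>\<epsilon> / 2 - \<rho>\<rfloor>) - \<epsilon> / 2\<bar> < \<epsilon> / 2"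
    using k(2) unfolding \<alpha>_def n frac_def by (simp add: algebra_simps)
  then show ?thesis
    by (intro that[of n "\<lfloor>real (Suc n) * \<theta>\<rfloor> - \<lfloor>\<epsilon> / 2 - \<rho>\<rfloor>"]) linarith+
qed

text \<open>Raising the intercept by \<delta> turns an approach from above within \<delta> into one
  from below.\<close>

lemma dense_below_integer:
  assumes "\<epsilon> > 0"
  obtains n M where "0 < of_int M - real (Suc n) * \<theta> - \<rho>" "of_int M - real (Suc n) * \<theta> - \<rho> < \<epsilon>"
proof -
  define \<delta> where "\<delta> = min \<epsilon> 1"
  obtain n M where "0 < real (Suc n) * \<theta> + (\<rho> + \<delta>) - of_int M"
    "real (Suc n) * \<theta> + (\<rho> + \<delta>) - of_int M < \<delta>"
    using dense_above_integer[of \<delta> "\<rho> + \<delta>"] assms by (auto simp: \<delta>_def)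
  then show ?thesis
    by (intro that[of M n]) (auto simp: \<delta>_def min_def split: if_splits)
qed

end

section \<open>Suffixes of Sturmian words with a prescribed long prefix\<close>

lemma eq_prefix_of_window_sum:
  assumes "\<And>j. j \<le> k \<Longrightarrow> window_sum v 0 j = window_sum w 0 j" "i < k"
  shows "v i = w i"
  using assms(1)[of "Suc i"] assms(1)[of i] assms(2) by simp

lemma positive_lower_bound:
  fixes f :: "nat \<Rightarrow> real"
  assumes "\<And>j. f j > 0"
  obtains \<epsilon> where "\<epsilon> > 0" "\<And>j. j \<le> k \<Longrightarrow> \<epsilon> \<le> f j"
proof -
  have "Min (f ` {..k}) > 0" "\<And>j. j \<le> k \<Longrightarrow> Min (f ` {..k}) \<le> f j"
    using assms by simp_all
  then show thesis
    by (rule that)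
qed

text \<open>Rounding commutes with integer translations, so only the offset from \<open>M\<close>
  matters. It is measured at \<open>Suc n\<close>, not at \<open>n\<close>, to match the terms
  \<open>(real k - 1) * \<theta>\<close> in the prefix sums of \<open>10c\<close> and
  \<open>01c\<close>.\<close>

lemma window_at_near_integer:
  assumes "window_sum s n j = F (real (n + j) * \<theta> + \<rho>) - F (real n * \<theta> + \<rho>)"
    and "F = floor \<or> F = ceiling"
  shows "window_sum s n j =
    F ((real j - 1) * \<theta> + (real (Suc n) * \<theta> + \<rho> - of_int M)) -
    F (- \<theta> + (real (Suc n) * \<theta> + \<rho> - of_int M))"
proof -
  have shift: "F x = F (x - of_int M) + M" for x
    using assms(2) by auto
  have eqs: "real (n + j) * \<theta> + \<rho> - of_int M = (real j - 1) * \<theta> + (real (Suc n) * \<theta> + \<rho> - of_int M)"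
    "real n * \<theta> + \<rho> - of_int M = - \<theta> + (real (Suc n) * \<theta> + \<rho> - of_int M)"
    by (simp_all add: algebra_simps)
  show ?thesis
    unfolding assms(1) shift[of "real (n + j) * \<theta> + \<rho>"] shift[of "real n * \<theta> + \<rho>"] eqs by simp
qed

text \<open>A small positive offset \<delta> crosses no integer for \<open>j \<le> k\<close>:
  rounding yields the floor of \<open>(real j - 1) * \<theta>\<close> plus a constant depending only
  on \<open>F\<close>. The constant cancels in the window sum, and the value -1 at
  \<open>j = 0\<close> leaves the summand 1 of \<open>10c\<close>.\<close>

lemma sturmian_approx_one_zero:
  assumes \<theta>: "\<theta> \<notin> \<rat>" "0 < \<theta>" "\<theta> < 1" and F: "F = floor \<or> F = ceiling"
    and s: "\<And>n k. window_sum s n k = F (real (n + k) * \<theta> + \<rho>) - F (real n * \<theta> + \<rho>)"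
  shows "\<exists>n. \<forall>i<k. suffix n s i = (1 ## 0 ## char_sturmian \<theta>) i"
proof -
  have "1 - frac x > 0" for x :: real
    by (simp add: frac_lt_1)
  then obtain \<epsilon> where \<epsilon>: "\<epsilon> > 0" "\<And>j. j \<le> k \<Longrightarrow> \<epsilon> \<le> 1 - frac ((real j - 1) * \<theta>)"
    using positive_lower_bound[of "\<lambda>j. 1 - frac ((real j - 1) * \<theta>)" k] by blast
  obtain n M where nM: "0 < real (Suc n) * \<theta> + \<rho> - of_int M" "real (Suc n) * \<theta> + \<rho> - of_int M < \<epsilon>"
    using dense_above_integer[OF \<theta> \<epsilon>(1)] by blast
  define \<delta> where "\<delta> = real (Suc n) * \<theta> + \<rho> - of_int M"
  obtain c where c: "F ((real j - 1) * \<theta> + \<delta>) = \<lfloor>(real j - 1) * \<theta>\<rfloor> + c" if "j \<le> k" for j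
  proof -
    have "(real j - 1) * \<theta> + \<delta> < of_int (\<lfloor>(real j - 1) * \<theta>\<rfloor> + 1)" if "j \<le> k" for j
      using \<epsilon>(2)[OF that] nM unfolding \<delta>_def[symmetric] frac_def by simp
    moreover have "of_int \<lfloor>(real j - 1) * \<theta>\<rfloor> < (real j - 1) * \<theta> + \<delta>" for j
      using nM(1) unfolding \<delta>_def[symmetric] by linarith
    ultimately have "F ((real j - 1) * \<theta> + \<delta>) = \<lfloor>(real j - 1) * \<theta>\<rfloor> + (if F = floor then 0 else 1)"
      if "j \<le> k" for j
      using F that by (cases "F = floor") (auto intro!: floor_unique ceiling_unique less_imp_le)
    then show thesis
      by (rule that)
  qed
  have "window_sum s n j = window_sum (1 ## 0 ## char_sturmian \<theta>) 0 j" if "j \<le> k" for j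
    using window_at_near_integer[OF s F, of n j M] c[OF that] c[of 0] floor_slope[OF \<theta>]
    unfolding \<delta>_def[symmetric] window_sum_one_zero_char[OF \<theta>] by simp
  then show ?thesis
    using eq_prefix_of_window_sum[of k "suffix n s"] unfolding window_sum_suffix by blast
qed

text \<open>Now the offset is slightly negative, and rounding yields ceilings up to a common
  constant. It cancels, and the ceiling at \<open>j = 0\<close> is 0.\<close>

lemma sturmian_approx_zero_one:
  assumes \<theta>: "\<theta> \<notin> \<rat>" "0 < \<theta>" "\<theta> < 1" and F: "F = floor \<or> F = ceiling"
    and s: "\<And>n k. window_sum s n k = F (real (n + k) * \<theta> + \<rho>) - F (real n * \<theta> + \<rho>)"
  shows "\<exists>n. \<forall>i<k. suffix n s i = (0 ## 1 ## char_sturmian \<theta>) i"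
proof -
  have "x - of_int \<lceil>x\<rceil> + 1 > 0" for x :: real
    by linarith
  then obtain \<epsilon> where \<epsilon>: "\<epsilon> > 0"
    "\<And>j. j \<le> k \<Longrightarrow> \<epsilon> \<le> (real j - 1) * \<theta> - of_int \<lceil>(real j - 1) * \<theta>\<rceil> + 1"
    using positive_lower_bound[of "\<lambda>j. (real j - 1) * \<theta> - of_int \<lceil>(real j - 1) * \<theta>\<rceil> + 1" k] by blast
  obtain n M where nM: "0 < of_int M - real (Suc n) * \<theta> - \<rho>" "of_int M - real (Suc n) * \<theta> - \<rho> < \<epsilon>"
    using dense_below_integer[OF \<theta> \<epsilon>(1)] by blast
  define \<delta> where "\<delta> = real (Suc n) * \<theta> + \<rho> - of_int M"
  have \<delta>: "\<delta> < 0" "- \<epsilon> < \<delta>"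
    using nM unfolding \<delta>_def by linarith+
  obtain c where c: "F ((real j - 1) * \<theta> + \<delta>) = \<lceil>(real j - 1) * \<theta>\<rceil> - c" if "j \<le> k" for j
  proof -
    have "of_int (\<lceil>(real j - 1) * \<theta>\<rceil> - 1) < (real j - 1) * \<theta> + \<delta>" if "j \<le> k" for j
      using \<epsilon>(2)[OF that] \<delta> by simp
    moreover have "(real j - 1) * \<theta> + \<delta> < of_int \<lceil>(real j - 1) * \<theta>\<rceil>" for j
      using \<delta>(1) by linarith
    ultimately have "F ((real j - 1) * \<theta> + \<delta>) = \<lceil>(real j - 1) * \<theta>\<rceil> - (if F = floor then 1 else 0)"
      if "j \<le> k" for j
      using F that by (cases "F = floor") (auto intro!: floor_unique ceiling_unique less_imp_le)
    then show thesis
      by (rule that)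
  qed
  have "window_sum s n j = window_sum (0 ## 1 ## char_sturmian \<theta>) 0 j" if "j \<le> k" for j
    using window_at_near_integer[OF s F, of n j M] c[OF that] c[of 0] floor_slope[OF \<theta>]
    unfolding \<delta>_def[symmetric] window_sum_zero_one_char[OF \<theta>] by simp
  then show ?thesis
    using eq_prefix_of_window_sum[of k "suffix n s"] unfolding window_sum_suffix by blast
qed

text \<open>Window sums of length \<open>k\<close> lie between floor and ceiling of
  \<open>k * \<theta>\<close>. These are the prefix sums of \<open>0c\<close> and \<open>1c\<close>,
  so the slope estimate and both lexicographic bounds follow.\<close>

lemma sturmian_properties:
  assumes "sturmian s"
  obtains \<theta> where "\<theta> \<notin> \<rat>" "0 < \<theta>" "\<theta> < 1"
    and "\<And>n k. \<bar>of_int (window_sum s n k) - real k * \<theta>\<bar> \<le> 1"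
    and "\<And>n. lex_le (0 ## char_sturmian \<theta>) (suffix n s)"
    and "\<And>n. lex_le (suffix n s) (1 ## char_sturmian \<theta>)"
    and "\<And>k. \<exists>n. \<forall>i<k. suffix n s i = (1 ## 0 ## char_sturmian \<theta>) i"
    and "\<And>k. \<exists>n. \<forall>i<k. suffix n s i = (0 ## 1 ## char_sturmian \<theta>) i"
proof -
  obtain \<theta> F \<rho> where \<theta>: "\<theta> \<notin> \<rat>" "0 < \<theta>" "\<theta> < 1" and F: "F = floor \<or> F = ceiling"
    and s: "\<And>n k. window_sum s n k = F (real (n + k) * \<theta> + \<rho>) - F (real n * \<theta> + \<rho>)"
    using sturmian_window_sum[OF assms] by metis
  have bounds: "\<lfloor>real k * \<theta>\<rfloor> \<le> window_sum s n k" "window_sum s n k \<le> \<lceil>real k * \<theta>\<rceil>" for n k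
  proof -
    have eq: "real (n + k) * \<theta> + \<rho> = (real n * \<theta> + \<rho>) + real k * \<theta>"
      by (simp add: algebra_simps)
    show "\<lfloor>real k * \<theta>\<rfloor> \<le> window_sum s n k" "window_sum s n k \<le> \<lceil>real k * \<theta>\<rceil>"
      unfolding s eq by (rule floor_ceiling_diff_bounds[OF F])+
  qed
  show ?thesis
  proof (rule that[OF \<theta>])
    show "\<bar>of_int (window_sum s n k) - real k * \<theta>\<bar> \<le> 1" for n k
      using bounds[where n = n and k = k] by linarith
    show "lex_le (0 ## char_sturmian \<theta>) (suffix n s)" for n
      by (intro lex_le_window_sum) (unfold window_sum_zero_char[OF \<theta>] window_sum_suffix, rule bounds)
    show "lex_le (suffix n s) (1 ## char_sturmian \<theta>)" for n
      by (intro lex_le_window_sum) (unfold window_sum_one_char[OF \<theta>] window_sum_suffix, rule bounds)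
    show "\<exists>n. \<forall>i<k. suffix n s i = (1 ## 0 ## char_sturmian \<theta>) i" for k
      by (rule sturmian_approx_one_zero[OF \<theta> F s])
    show "\<exists>n. \<forall>i<k. suffix n s i = (0 ## 1 ## char_sturmian \<theta>) i" for k
      by (rule sturmian_approx_zero_one[OF \<theta> F s])
  qed
qed

section \<open>Doubled Sturmian words satisfy the alternate bounds\<close>

lemma doubled_alt_bounded:
  assumes "a \<in> {0, 1}" "binary_word s"
    and low: "\<And>n. lex_le (0 ## c) (suffix n s)" and up: "\<And>n. lex_le (suffix n s) (1 ## c)"
  shows "alt_bounded (double c) (replicate l a \<frown> double s)"
proof -
  define ok where "ok = (\<lambda>v. [1, 0, 0] \<frown> double c \<preceq>\<^sub>a\<^sub>l\<^sub>t v \<and> v \<preceq>\<^sub>a\<^sub>l\<^sub>t [0, 1, 1] \<frown> double c)"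
  \<comment> \<open>The bounding words start with \<open>10\<close> and \<open>01\<close>, so a
    repeated first letter decides both comparisons.\<close>
  have pair: "ok (b ## b ## v)" if "b \<in> {0, 1}" for b v
    using that by (auto simp: ok_def alt_le_build)
  \<comment> \<open>The tails \<open>00u\<close> and \<open>11u\<close> of the bounding words are
    the doubles of \<open>0 ## c\<close> and \<open>1 ## c\<close>, so the lexicographic bounds
    translate directly.\<close>
  have single: "ok (b ## double (suffix n s))" if "b \<in> {0, 1}" for b n
    using that double_antimono[OF low[of n]] double_antimono[OF up[of n]]
    unfolding double_build by (auto simp: ok_def alt_le_build)
  have s: "s n \<in> {0, 1}" for n
    using assms(2) by (auto simp: binary_word_iff)
  have "ok (suffix n (replicate l a \<frown> double s))" for n
  proof (cases "n < l")
    case True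
    then obtain j where j: "l - n = Suc j"
      by (metis Suc_diff_Suc)
    have eq: "suffix n (replicate l a \<frown> double s) = replicate (Suc j) a \<frown> double s"
      using True j by simp
    show ?thesis
    proof (cases j)
      case 0
      then show ?thesis
        unfolding eq using single[OF assms(1), of 0] by simp
    next
      case (Suc i)
      then show ?thesis
        unfolding eq using pair[OF assms(1)] by simp
    qed
  next
    case False
    then have eq: "suffix n (replicate l a \<frown> double s) = suffix (n - l) (double s)"
      by simp
    show ?thesis
    proof (cases "even (n - l)")
      case True
      then obtain m where "n - l = 2 * m" ..
      then show ?thesis
        unfolding eq using pair[OF s[of m]] by (simp only: suffix_double double_suffix_unfold[of m])
    next
      case False
      then obtain m where m: "n - l = 2 * m + 1" ..
      have "suffix (2 * m + 1) (double s) = suffix 1 (s m ## s m ## double (suffix (Suc m) s))"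
        by (metis double_suffix_unfold suffix_double suffix_suffix)
      also have "\<dots> = s m ## double (suffix (Suc m) s)"
        by (rule ext) simp
      finally show ?thesis
        unfolding eq m using single[OF s] by simp
    qed
  qed
  then show ?thesis
    by (simp add: alt_bounded_def ok_def)
qed

section \<open>The slope of a doubled word with a prefix\<close>

lemma sum_double:
  "(\<Sum>i<n. double s i) = (\<Sum>i<n div 2. s i) + (\<Sum>i<Suc n div 2. s i)"
proof (induction n)
  case (Suc n)
  then show ?case
    by (cases "even n") (auto simp: double_def add_ac elim!: evenE oddE)
qed simp

lemma has_slope_of_bounded:
  assumes "\<And>n. \<bar>of_int (\<Sum>i<n. w i) - real n * \<theta>\<bar> \<le> C"
  shows "has_slope w \<theta>"
proof -
  have sum: "(\<Sum>i=1..n. real_of_int (w (i - 1))) = of_int (\<Sum>i<n. w i)" for n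
    by (induction n) simp_all
  have "(\<lambda>n. 1 / real n * of_int (\<Sum>i<n. w i) - \<theta>) \<longlonglongrightarrow> 0"
  proof (rule Lim_null_comparison)
    show "\<forall>\<^sub>F n in sequentially. norm (1 / real n * of_int (\<Sum>i<n. w i) - \<theta>) \<le> C * (1 / real n)"
      using eventually_gt_at_top[of 0]
    proof eventually_elim
      case (elim n)
      then have "1 / real n * of_int (\<Sum>i<n. w i) - \<theta> = (of_int (\<Sum>i<n. w i) - real n * \<theta>) / real n"
        by (simp add: field_simps)
      then show ?case
        using assms[of n] elim by (simp add: abs_divide divide_right_mono del: of_int_sum)
    qed
    show "(\<lambda>n. C * (1 / real n)) \<longlonglongrightarrow> 0"
      by (intro tendsto_mult_right_zero lim_1_over_n)
  qed
  then show ?thesis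
    unfolding has_slope_def sum by (simp only: LIM_zero_iff)
qed

lemma has_slope_prefix_double:
  assumes "\<And>n k. \<bar>of_int (window_sum s n k) - real k * \<theta>\<bar> \<le> 1" "binary_word w"
    and w: "w = replicate l a \<frown> double s"
  shows "has_slope w \<theta>"
proof (rule has_slope_of_bounded)
  fix n
  \<comment> \<open>The first and the second copies of the letters of \<open>s\<close> each
    contribute an error of at most 1.\<close>
  have double: "\<bar>of_int (window_sum (double s) 0 k) - real k * \<theta>\<bar> \<le> 2" for k
  proof -
    have "k = k div 2 + Suc k div 2"
      by presburger
    then have "real k = real (k div 2) + real (Suc k div 2)"
      by (metis of_nat_add)
    then show ?thesis
      using assms(1)[of 0 "k div 2"] assms(1)[of 0 "Suc k div 2"]
      by (simp add: sum_double distrib_right del: of_int_sum) linarith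
  qed
  have prefix: "\<bar>of_int (window_sum w 0 k) - real k * \<theta>\<bar> \<le> real k * (1 + \<bar>\<theta>\<bar>)" for k
  proof -
    have "\<bar>of_int (window_sum w 0 k)\<bar> \<le> real k"
      using window_sum_bounds[OF assms(2), of 0 k] by linarith
    then show ?thesis
      using abs_triangle_ineq4[of "of_int (window_sum w 0 k)" "real k * \<theta>"]
      by (simp add: abs_mult algebra_simps del: of_int_sum)
  qed
  show "\<bar>of_int (\<Sum>i<n. w i) - real n * \<theta>\<bar> \<le> real l * (1 + \<bar>\<theta>\<bar>) + 2"
  proof (cases "n \<le> l")
    case True
    then have "real n * (1 + \<bar>\<theta>\<bar>) \<le> real l * (1 + \<bar>\<theta>\<bar>)"
      by (intro mult_right_mono) simp_all
    then show ?thesis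
      using prefix[of n] by simp
  next
    case False
    have "window_sum w l (n - l) = window_sum (double s) 0 (n - l)"
      by (simp add: w)
    then have "(\<Sum>i<n. w i) = window_sum w 0 l + window_sum (double s) 0 (n - l)"
      using window_sum_add[of w 0 l "n - l"] False by simp
    then have "real_of_int (\<Sum>i<n. w i) =
        of_int (window_sum w 0 l) + of_int (window_sum (double s) 0 (n - l))"
      by (simp only: of_int_add)
    moreover have "real n * \<theta> = real l * \<theta> + real (n - l) * \<theta>"
      using False by (simp add: of_nat_diff algebra_simps)
    ultimately have "of_int (\<Sum>i<n. w i) - real n * \<theta> = (of_int (window_sum w 0 l) - real l * \<theta>) +
        (of_int (window_sum (double s) 0 (n - l)) - real (n - l) * \<theta>)"
      by (simp only:)
    then show ?thesis
      using abs_triangle_ineq add_mono[OF prefix[of l] double[of "n - l"]] order_trans by metis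
  qed
qed

section \<open>Bounds on suffixes pass to limits of suffixes\<close>

lemma alt_le_limit_upper:
  assumes "\<And>k. \<exists>n. \<forall>i<k. suffix n w i = x i" "\<And>n. y \<preceq>\<^sub>a\<^sub>l\<^sub>t suffix n w"
  shows "y \<preceq>\<^sub>a\<^sub>l\<^sub>t x"
proof (rule ccontr)
  assume neg: "\<not> y \<preceq>\<^sub>a\<^sub>l\<^sub>t x"
  then have "x \<preceq>\<^sub>a\<^sub>l\<^sub>t y" "x \<noteq> y"
    using alt_le_linear[of x y] by auto
  then obtain j where j: "\<forall>i<j. x i = y i" "if even j then y j < x j else x j < y j"
    unfolding alt_le_iff by blast
  \<comment> \<open>A suffix agreeing with \<open>x\<close> through index \<open>j\<close> inherits
    the strict comparison with \<open>y\<close>.\<close>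
  obtain n where n: "\<forall>i<Suc j. suffix n w i = x i"
    using assms(1) by blast
  have "suffix n w \<preceq>\<^sub>a\<^sub>l\<^sub>t y"
    unfolding alt_le_iff by (intro disjI2 exI[of _ j]) (use n j in \<open>simp del: suffix_nth\<close>)
  then have "y = suffix n w"
    using assms(2) alt_le_antisym by blast
  then have "y j = x j"
    using n by (simp del: suffix_nth)
  with j(2) show False
    by (simp split: if_splits)
qed

lemma alt_le_limit_lower:
  assumes "\<And>k. \<exists>n. \<forall>i<k. suffix n w i = x i" "\<And>n. suffix n w \<preceq>\<^sub>a\<^sub>l\<^sub>t y"
  shows "x \<preceq>\<^sub>a\<^sub>l\<^sub>t y"
proof -
  have "compl_word y \<preceq>\<^sub>a\<^sub>l\<^sub>t compl_word x"
  proof (rule alt_le_limit_upper)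
    show "\<exists>n. \<forall>i<k. suffix n (compl_word w) i = compl_word x i" for k
      using assms(1)[of k] by auto
    show "compl_word y \<preceq>\<^sub>a\<^sub>l\<^sub>t suffix n (compl_word w)" for n
      unfolding suffix_compl_word compl_word_alt_le by (rule assms(2))
  qed
  then show ?thesis
    by (simp add: compl_word_alt_le)
qed

text \<open>Starting at the odd position \<open>2 * m + 1\<close> of the doubled word keeps one copy
  of the first letter. Thus \<open>10c\<close> and \<open>01c\<close> become \<open>100u\<close> and
  \<open>011u\<close> with \<open>u = Dc\<close>.\<close>

lemma doubled_approx:
  assumes "\<And>k. \<exists>n. \<forall>i<k. suffix n s i = (a ## x) i"
  shows "\<exists>n. \<forall>i<k. suffix n (replicate l b \<frown> double s) i = (a ## double x) i"
proof -
  obtain m where m: "\<And>i. i < Suc k \<Longrightarrow> suffix m s i = (a ## x) i"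
    using assms[of "Suc k"] by blast
  have "suffix (l + (2 * m + 1)) (replicate l b \<frown> double s) i = (a ## double x) i" if "i < k" for i
  proof -
    have "suffix (l + (2 * m + 1)) (replicate l b \<frown> double s) i = double s (2 * m + Suc i)"
      by (simp add: add.assoc)
    also have "\<dots> = double (suffix m s) (Suc i)"
      by (metis suffix_double suffix_nth)
    also have "\<dots> = double (a ## x) (Suc i)"
      using m[of "Suc i div 2"] that unfolding double_def by simp
    also have "\<dots> = (a ## double x) i"
      by (simp add: double_build)
    finally show ?thesis .
  qed
  then show ?thesis
    by blast
qed

section \<open>The characterization, uniqueness of \<open>u\<close>, and the extremal words\<close>

lemma alt_bounded_imp_doubled_sturmian:
  assumes "binary_word w" "binary_word u" "alt_bounded u w" "aperiodic w"
  shows "w \<in> doubled_sturmian"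
proof -
  obtain l s where w: "w = replicate (Suc l) (1 - s 0) \<frown> double s"
    and s: "binary_word s" "aperiodic s"
    using alt_bounded_imp_double[OF assms] by blast
  \<comment> \<open>The word \<open>u\<close> separates the doubled tails following a 0 from those
    following a 1; undoing the doubling reverses the order.\<close>
  have "lex_le (suffix (Suc n) s) (suffix (Suc m) s)" if "s n = 1" "s m = 0" for n m
    using alt_bounded_double_order[OF w assms(1) s(1) assms(3)] that alt_le_trans double_le_iff by blast
  then have "sturmian s"
    using aperiodic_balanced_imp_sturmian order_imp_balanced s by blast
  moreover have "1 - s 0 \<in> {0, 1}"
    using s(1)[unfolded binary_word_iff, rule_format, of 0] by auto
  ultimately show ?thesis
    unfolding doubled_sturmian_def using w by blast
qed

lemma binary_word_double: "binary_word w \<Longrightarrow> binary_word (double w)"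
  by (simp add: binary_word_iff double_def)

lemma doubled_sturmian_properties:
  assumes "w \<in> doubled_sturmian" "binary_word w"
  obtains \<theta> where "\<theta> \<notin> \<rat>" "0 < \<theta>" "\<theta> < 1" "has_slope w \<theta>"
    and "alt_bounded (double (char_sturmian \<theta>)) w"
    and "\<And>k. \<exists>n. \<forall>i<k. suffix n w i = ([1, 0, 0] \<frown> double (char_sturmian \<theta>)) i"
    and "\<And>k. \<exists>n. \<forall>i<k. suffix n w i = ([0, 1, 1] \<frown> double (char_sturmian \<theta>)) i"
proof -
  obtain l a s where w: "w = replicate l a \<frown> double s" and a: "a \<in> {0, 1}" and s: "sturmian s"
    using assms(1) unfolding doubled_sturmian_def by blast
  then have bin: "binary_word s"
    by (simp add: sturmian_def)
  obtain \<theta> where \<theta>: "\<theta> \<notin> \<rat>" "0 < \<theta>" "\<theta> < 1"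
    and slope: "\<And>n k. \<bar>of_int (window_sum s n k) - real k * \<theta>\<bar> \<le> 1"
    and low: "\<And>n. lex_le (0 ## char_sturmian \<theta>) (suffix n s)"
    and up: "\<And>n. lex_le (suffix n s) (1 ## char_sturmian \<theta>)"
    and approx: "\<And>k. \<exists>n. \<forall>i<k. suffix n s i = (1 ## 0 ## char_sturmian \<theta>) i"
      "\<And>k. \<exists>n. \<forall>i<k. suffix n s i = (0 ## 1 ## char_sturmian \<theta>) i"
    using sturmian_properties[OF s] by metis
  show ?thesis
  proof (rule that[OF \<theta>])
    show "has_slope w \<theta>"
      using has_slope_prefix_double[OF slope assms(2) w] .
    show "alt_bounded (double (char_sturmian \<theta>)) w"
      unfolding w by (rule doubled_alt_bounded[OF a bin low up])
    show "\<exists>n. \<forall>i<k. suffix n w i = ([1, 0, 0] \<frown> double (char_sturmian \<theta>)) i" for k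
      using doubled_approx[OF approx(1), of k l a] by (simp add: w double_build)
    show "\<exists>n. \<forall>i<k. suffix n w i = ([0, 1, 1] \<frown> double (char_sturmian \<theta>)) i" for k
      using doubled_approx[OF approx(2), of k l a] by (simp add: w double_build)
  qed
qed

text \<open>In the limit the bounds by \<open>u\<close> compare \<open>100u\<close> with
  \<open>100c\<close> and \<open>011u\<close> with \<open>011c\<close>. Cancelling three letters
  reverses each comparison, which gives both inequalities between \<open>u\<close> and
  \<open>c\<close>.\<close>

lemma alt_bounded_unique:
  assumes "alt_bounded u w" "alt_bounded c w"
    and "\<And>k. \<exists>n. \<forall>i<k. suffix n w i = ([1, 0, 0] \<frown> c) i"
    and "\<And>k. \<exists>n. \<forall>i<k. suffix n w i = ([0, 1, 1] \<frown> c) i"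
  shows "u = c"
proof -
  have "[1, 0, 0] \<frown> u \<preceq>\<^sub>a\<^sub>l\<^sub>t [1, 0, 0] \<frown> c"
    by (rule alt_le_limit_upper[OF assms(3)]) (use assms(1) in \<open>simp only: alt_bounded_def\<close>)
  moreover have "[0, 1, 1] \<frown> c \<preceq>\<^sub>a\<^sub>l\<^sub>t [0, 1, 1] \<frown> u"
    by (rule alt_le_limit_lower[OF assms(4)]) (use assms(1) in \<open>simp only: alt_bounded_def\<close>)
  ultimately show ?thesis
    by (simp add: alt_le_build alt_le_antisym)
qed

theorem corollary1p3:
  fixes w :: "int word"
  assumes "binary_word w" and "aperiodic w"
  shows "(w \<in> doubled_sturmian \<longleftrightarrow>
      (\<exists>u. binary_word u \<and>
        (\<forall>n. [1, 0, 0] \<frown> u \<preceq>\<^sub>a\<^sub>l\<^sub>t suffix n w \<and> suffix n w \<preceq>\<^sub>a\<^sub>l\<^sub>t [0, 1, 1] \<frown> u))) \<and>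
    (\<forall>u. binary_word u \<and>
        (\<forall>n. [1, 0, 0] \<frown> u \<preceq>\<^sub>a\<^sub>l\<^sub>t suffix n w \<and> suffix n w \<preceq>\<^sub>a\<^sub>l\<^sub>t [0, 1, 1] \<frown> u) \<longrightarrow>
      (\<exists>\<theta>. has_slope w \<theta> \<and> \<theta> \<notin> \<rat> \<and> 0 < \<theta> \<and> \<theta> < 1 \<and> u = double (char_sturmian \<theta>)) \<and>
      is_alt_inf (range (\<lambda>n. suffix n w)) ([1, 0, 0] \<frown> u) \<and>
      is_alt_sup (range (\<lambda>n. suffix n w)) ([0, 1, 1] \<frown> u))"
  unfolding alt_bounded_def[symmetric]
proof (intro conjI allI impI)
  show "w \<in> doubled_sturmian \<longleftrightarrow> (\<exists>u. binary_word u \<and> alt_bounded u w)"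
  proof
    assume "w \<in> doubled_sturmian"
    then obtain \<theta> where "\<theta> \<notin> \<rat>" "0 < \<theta>" "\<theta> < 1" "alt_bounded (double (char_sturmian \<theta>)) w"
      using doubled_sturmian_properties assms(1) by metis
    then show "\<exists>u. binary_word u \<and> alt_bounded u w"
      using binary_word_char_sturmian binary_word_double by blast
  qed (use alt_bounded_imp_doubled_sturmian assms in blast)
next
  fix u assume u: "binary_word u \<and> alt_bounded u w"
  then have bounds: "[1, 0, 0] \<frown> u \<preceq>\<^sub>a\<^sub>l\<^sub>t suffix n w" "suffix n w \<preceq>\<^sub>a\<^sub>l\<^sub>t [0, 1, 1] \<frown> u" for n
    unfolding alt_bounded_def by blast+
  have "w \<in> doubled_sturmian"
    using u alt_bounded_imp_doubled_sturmian assms by blast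
  then obtain \<theta> where \<theta>: "\<theta> \<notin> \<rat>" "0 < \<theta>" "\<theta> < 1" "has_slope w \<theta>"
    and c: "alt_bounded (double (char_sturmian \<theta>)) w"
    and inf: "\<And>k. \<exists>n. \<forall>i<k. suffix n w i = ([1, 0, 0] \<frown> double (char_sturmian \<theta>)) i"
    and sup: "\<And>k. \<exists>n. \<forall>i<k. suffix n w i = ([0, 1, 1] \<frown> double (char_sturmian \<theta>)) i"
    using doubled_sturmian_properties[OF _ assms(1)] by metis
  have eq: "u = double (char_sturmian \<theta>)"
    using alt_bounded_unique[OF _ c inf sup] u by blast
  then show "\<exists>\<theta>. has_slope w \<theta> \<and> \<theta> \<notin> \<rat> \<and> 0 < \<theta> \<and> \<theta> < 1 \<and> u = double (char_sturmian \<theta>)"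
    using \<theta> by blast
  have "binary_word ([1, 0, 0] \<frown> u)" "binary_word ([0, 1, 1] \<frown> u)"
    using u by (auto simp: binary_word_def)
  \<comment> \<open>Both words are limits of suffixes, so any common bound of all suffixes also
    bounds them; hence they are the best bounds.\<close>
  then show "is_alt_inf (range (\<lambda>n. suffix n w)) ([1, 0, 0] \<frown> u)"
    "is_alt_sup (range (\<lambda>n. suffix n w)) ([0, 1, 1] \<frown> u)"
    unfolding is_alt_inf_def is_alt_sup_def
    using bounds alt_le_limit_upper[OF inf[folded eq]] alt_le_limit_lower[OF sup[folded eq]] by blast+
qed

end
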